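(* Let $d\ge 5$, and let $l_\infty$ and $\tilde l_\infty$ be the infinite-time local times of two independent aperiodic simple random walks on $\mathbb{Z}^d$, both started at $0$. For a positive integer $n$ let $\mathcal{L}(n)=\{z\in\mathbb{Z}^d:\ l_\infty(z)=n\}$ and $\tilde{\mathcal{L}}(n)=\{z\in\mathbb{Z}^d:\ \tilde l_\infty(z)=n\}$. There are positive constants $\kappa_d, C_d$ such that for all positive integers $n,m,L$, $$\mathbb{P}\Big(\big|\mathcal{L}(n)\cap\tilde{\mathcal{L}}(m)\big|\ge L\Big)\le (C_d\, n\, m)^L\,(L!)^{2d}\,\exp\Big(-\kappa_d\,(n+m)\,L^{1-\frac{2}{d}}\Big).$$
   Context: The aperiodic simple random walk on $\mathbb{Z}^d$ is the Markov chain for which, given $S_n$, the position $S_{n+1}$ is uniform on the $2d+1$ sites $\{z\in\mathbb{Z}^d:\ |z-S_n|\le 1\}$, where $|z|=|z_1|+\dots+|z_d|$. $(S_n)$ and $(\tilde S_n)$ are two independent such walks started at $0$, and $\mathbb{P}=P_0\otimes\tilde P_0$ is their joint law. Local times: $l_\infty(z)=\sum_{k=0}^\infty\mathbf{1}\{S_k=z\}$ and $\tilde l_\infty(z)=\sum_{k=0}^\infty\mathbf{1}\{\tilde S_k=z\}$. The constants $\kappa_d,C_d$ depend only on $d$. *)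

theory Defs
  imports "HOL-Probability.Probability"
begin

text \<open>The lattice \<open>\<int>\<^sup>d\<close> is \<^typ>\<open>int ^ 'd\<close>, with \<open>d = CARD('d)\<close>.\<close>

definition l1_norm :: "int ^ 'd \<Rightarrow> int" where
  "l1_norm z = (\<Sum>i\<in>UNIV. \<bar>z $ i\<bar>)"

definition neighbours :: "int ^ 'd \<Rightarrow> (int ^ 'd) set" where
  "neighbours x = {z. l1_norm (z - x) \<le> 1}"

lemma self_in_neighbours: "x \<in> neighbours x"
  by (simp add: neighbours_def l1_norm_def)

lemma finite_neighbours: "finite (neighbours x)"
proof (rule finite_subset)
  have comp: "\<bar>(z - x) $ i\<bar> \<le> 1" if "z \<in> neighbours x" for z i
  proof -
    have "\<bar>(z - x) $ i\<bar> \<le> (\<Sum>j\<in>UNIV. \<bar>(z - x) $ j\<bar>)"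
      by (rule member_le_sum) auto
    with that show ?thesis by (simp add: neighbours_def l1_norm_def)
  qed
  show "neighbours x \<subseteq> vec_lambda ` (\<Pi>\<^sub>E i\<in>UNIV. {x $ i - 1 .. x $ i + 1})"
  proof
    fix z assume "z \<in> neighbours x"
    then have "vec_nth z \<in> (\<Pi>\<^sub>E i\<in>UNIV. {x $ i - 1 .. x $ i + 1})"
      using comp[of z] by (auto simp: PiE_iff abs_le_iff) (smt (verit) vector_minus_component)+
    then show "z \<in> vec_lambda ` (\<Pi>\<^sub>E i\<in>UNIV. {x $ i - 1 .. x $ i + 1})"
      by (metis image_eqI vec_nth_inverse)
  qed
  show "finite (vec_lambda ` (\<Pi>\<^sub>E i\<in>UNIV. {x $ i - 1 .. x $ i + 1}))"
    by (intro finite_imageI finite_PiE) auto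
qed

text \<open>
  The walk is built from its transition kernels by the Ionescu-Tulcea theorem:
  \<open>walk_kernel n S\<close> is the law of \<open>S n\<close> given the earlier positions \<open>S 0, \<dots>, S (n - 1)\<close>.
\<close>

definition walk_kernel :: "nat \<Rightarrow> (nat \<Rightarrow> int ^ 'd) \<Rightarrow> (int ^ 'd) measure" where
  "walk_kernel n S =
     measure_pmf (case n of 0 \<Rightarrow> return_pmf 0 | Suc k \<Rightarrow> pmf_of_set (neighbours (S k)))"

interpretation walk: Ionescu_Tulcea walk_kernel "\<lambda>_. count_space (UNIV :: (int ^ 'd) set)"
proof (rule Ionescu_Tulcea.intro)
  fix n
  show "walk_kernel n \<in> (\<Pi>\<^sub>M k\<in>{0..<n}. count_space (UNIV :: (int ^ 'd) set))
          \<rightarrow>\<^sub>M subprob_algebra (count_space UNIV)"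
  proof (cases n)
    case 0
    then show ?thesis
      by (simp add: walk_kernel_def[abs_def] measure_pmf_in_subprob_algebra)
  next
    case (Suc k)
    have "(\<lambda>S. S k) \<in> (\<Pi>\<^sub>M k\<in>{0..<n}. count_space (UNIV :: (int ^ 'd) set))
            \<rightarrow>\<^sub>M count_space UNIV"
      using Suc by (intro measurable_component_singleton) auto
    then have "(\<lambda>S. measure_pmf (pmf_of_set (neighbours (S k))))
                \<in> (\<Pi>\<^sub>M k\<in>{0..<n}. count_space (UNIV :: (int ^ 'd) set))
                  \<rightarrow>\<^sub>M subprob_algebra (count_space UNIV)"
      by (rule measurable_compose) (simp add: measure_pmf_in_subprob_algebra)
    with Suc show ?thesis by (simp add: walk_kernel_def[abs_def])
  qed
next
  show "prob_space (walk_kernel n S)" for n and S :: "nat \<Rightarrow> int ^ 'd"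
    unfolding walk_kernel_def by (rule prob_space_measure_pmf)
qed

definition walk_law :: "(nat \<Rightarrow> int ^ 'd) measure" where
  "walk_law = walk.PF.lim"

lemma sets_walk_law [measurable_cong]:
  "sets walk_law = sets (\<Pi>\<^sub>M k\<in>UNIV. count_space (UNIV :: (int ^ 'd) set))"
  by (simp add: walk_law_def)

lemma space_walk_law [simp]: "space walk_law = UNIV"
  by (simp add: walk_law_def space_PiM)

definition local_time :: "(nat \<Rightarrow> int ^ 'd) \<Rightarrow> int ^ 'd \<Rightarrow> ennreal" where
  "local_time S z = (\<Sum>k. of_bool (S k = z))"

definition level_set :: "(nat \<Rightarrow> int ^ 'd) \<Rightarrow> nat \<Rightarrow> (int ^ 'd) set" where
  "level_set S n = {z. local_time S z = of_nat n}"

text \<open>\<open>\<bar>A\<bar> \<ge> n\<close>, allowing infinite \<open>A\<close> (for which \<^const>\<open>card\<close> is \<open>0\<close>).\<close>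

definition card_at_least :: "'a set \<Rightarrow> nat \<Rightarrow> bool" where
  "card_at_least A n \<longleftrightarrow> infinite A \<or> n \<le> card A"

lemma card_at_least_iff: "card_at_least A n \<longleftrightarrow> (\<exists>B\<subseteq>A. finite B \<and> card B = n)"
  unfolding card_at_least_def
  by (metis card_mono infinite_arbitrarily_large obtain_subset_with_card_n)

text \<open>\<open>Sigma_Algebra.measure\<close> is \<open>0\<close> on non-measurable sets, so the following two facts
  ensure that the probability in the theorem is the intended one.\<close>

interpretation walk_law: prob_space "walk_law :: (nat \<Rightarrow> int ^ 'd) measure"
proof
  let ?M = "\<lambda>_ :: nat. count_space (UNIV :: (int ^ 'd) set)"
  interpret CI: prob_space "walk.CI {} :: (nat \<Rightarrow> int ^ 'd) measure"
    by (rule walk.PF.prob_space_P) auto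
  have "emeasure walk.PF.lim (walk.PF.emb UNIV {} (space (PiM {} ?M)))
      = emeasure (walk.CI {}) (space (PiM {} ?M))"
    by (rule walk.lim) auto
  moreover have "space (walk.CI {}) = space (PiM {} ?M)"
    by (simp add: walk.PF.space_P)
  moreover have "walk.PF.emb UNIV {} (space (PiM {} ?M)) = space walk_law"
    by (auto simp: prod_emb_def space_PiM)
  ultimately show "emeasure (walk_law :: (nat \<Rightarrow> int ^ 'd) measure) (space walk_law) = 1"
    using CI.emeasure_space_1 by (simp add: walk_law_def)
qed

lemma level_set_event_measurable:
  "{\<omega> \<in> space (walk_law \<Otimes>\<^sub>M walk_law).
      card_at_least (level_set (fst \<omega>) n \<inter> level_set (snd \<omega> :: nat \<Rightarrow> int ^ 'd) m) L}
   \<in> sets (walk_law \<Otimes>\<^sub>M walk_law)"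
proof -
  have [measurable]: "(\<lambda>S. S k) \<in> walk_law \<rightarrow>\<^sub>M count_space (UNIV :: (int ^ 'd) set)" for k
    by (simp add: measurable_cong_sets[OF sets_walk_law refl])
  have [measurable]: "(\<lambda>S. of_bool (S k = z) :: ennreal) \<in> borel_measurable walk_law"
    for k and z :: "int ^ 'd"
    unfolding of_bool_def by measurable
  have [measurable]: "(\<lambda>S. local_time S z) \<in> borel_measurable walk_law" for z :: "int ^ 'd"
    unfolding local_time_def by measurable
  have *: "card_at_least (level_set (fst \<omega>) n \<inter> level_set (snd \<omega>) m) L \<longleftrightarrow>
      (\<exists>B\<in>{B. finite B \<and> card B = L}. \<forall>z\<in>B. local_time (fst \<omega>) z = of_nat n \<and> local_time (snd \<omega>) z = of_nat m)"
    for \<omega> :: "(nat \<Rightarrow> int ^ 'd) \<times> (nat \<Rightarrow> int ^ 'd)"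
    unfolding card_at_least_iff level_set_def by blast
  have "countable {B :: (int ^ 'd) set. finite B \<and> card B = L}"
    by (rule countable_subset[OF _ countable_Collect_finite]) auto
  then show ?thesis
    unfolding * by measurable
qed

end

theory Submission
  imports Defs
begin

text \<open>
  For a finite set \<open>A\<close> of \<open>L\<close> sites let \<open>p\<^sub>n(A)\<close> be the probability that the walk has local time
  \<open>n\<close> at every site of \<open>A\<close>; by a union bound and independence the probability in question is at
  most \<open>\<Sum>\<^sub>A p\<^sub>n(A) p\<^sub>m(A)\<close>. Two bounds on \<open>p\<^sub>n(A)\<close> are interpolated.

  The walk spends total time \<open>n L\<close> in \<open>A\<close>, whereas from any starting point the expected time is at
  most \<open>M = B L\<^bsup>2/d\<^esup>\<close>, by the heat kernel bound \<open>C k\<^bsup>-d/2\<^esup>\<close>. The expected number of \<open>k\<close>-subsets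
  of the times spent in \<open>A\<close> is therefore at most \<open>M\<^sup>k\<close>, so that \<open>p\<^sub>n(A) \<le> M\<^sup>k / (n L choose k)\<close>;
  with \<open>k\<close> about \<open>n L / (3 M)\<close> this is at most \<open>exp (1 - \<kappa> n L\<^bsup>1-2/d\<^esup>)\<close>. On the other hand, all
  sites of \<open>A\<close> are visited in some order, so \<open>p\<^sub>n(A)\<close> is at most \<open>L!\<close> times the largest product of
  Green functions along an enumeration of \<open>A\<close>.

  Raising the first bound for \<open>p\<^sub>n(A) p\<^sub>m(A)\<close> to the power \<open>1/16\<close> and the second to the power
  \<open>15/16\<close> leaves the sum over \<open>A\<close> of products of \<open>15/8\<close>-th powers of Green functions. It is
  geometric in \<open>L\<close>, because \<open>G\<^sup>p\<close> is summable over the lattice for some \<open>p < 2\<close> when \<open>d \<ge> 5\<close>.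
\<close>

section \<open>The heat kernel\<close>

lemma neighbours_eq:
  "neighbours (x :: int ^ 'd) = insert x ((\<lambda>(i, s). x + axis i s) ` (UNIV \<times> {1, -1}))"
proof (intro equalityI subsetI)
  fix z assume "z \<in> neighbours x"
  then have le: "(\<Sum>j\<in>UNIV. \<bar>(z - x) $ j\<bar>) \<le> 1"
    by (simp add: neighbours_def l1_norm_def)
  show "z \<in> insert x ((\<lambda>(i, s). x + axis i s) ` (UNIV \<times> {1, -1}))"
  proof (cases "z = x")
    case False
    then obtain i where i: "(z - x) $ i \<noteq> 0"
      by (auto simp: vec_eq_iff)
    have "(\<Sum>j\<in>UNIV. \<bar>(z - x) $ j\<bar>) = \<bar>(z - x) $ i\<bar> + (\<Sum>j\<in>UNIV - {i}. \<bar>(z - x) $ j\<bar>)"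
      by (rule sum.remove) auto
    moreover have "(\<Sum>j\<in>UNIV - {i}. \<bar>(z - x) $ j\<bar>) \<ge> 0"
      by (rule sum_nonneg) auto
    ultimately have *: "\<bar>(z - x) $ i\<bar> = 1" "(\<Sum>j\<in>UNIV - {i}. \<bar>(z - x) $ j\<bar>) = 0"
      using le i by linarith+
    have "\<forall>j\<in>UNIV - {i}. \<bar>(z - x) $ j\<bar> = 0"
      using *(2) by (subst (asm) sum_nonneg_eq_0_iff) simp_all
    then have "z = x + axis i ((z - x) $ i)"
      by (simp add: vec_eq_iff axis_def)
    moreover have "(z - x) $ i \<in> {1, -1}"
    proof -
      have "(z - x) $ i = 1 \<or> (z - x) $ i = -1"
        using *(1) by linarith
      then show ?thesis
        by blast
    qed
    ultimately have "z \<in> (\<lambda>(i, s). x + axis i s) ` (UNIV \<times> {1, -1})"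
      by (intro image_eqI[of _ _ "(i, (z - x) $ i)"]) simp_all
    then show ?thesis
      by (rule insertI2)
  qed simp
next
  have "x + axis i s \<in> neighbours x" if "\<bar>s\<bar> = 1" for i s
  proof -
    have "\<bar>axis i s $ j\<bar> = (if j = i then 1 else 0)" for j
      using that by (simp add: axis_def)
    then show ?thesis
      by (simp add: neighbours_def l1_norm_def)
  qed
  then show "z \<in> neighbours x"
    if "z \<in> insert x ((\<lambda>(i, s). x + axis i s) ` (UNIV \<times> {1, -1}))" for z
    using that by (auto simp: self_in_neighbours)
qed

lemma sum_neighbours:
  fixes g :: "int ^ 'd \<Rightarrow> 'b :: comm_monoid_add"
  shows "sum g (neighbours x) = g x + (\<Sum>i\<in>UNIV. g (x + axis i 1) + g (x - axis i 1))"
proof -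
  have neg: "x - axis i 1 = x + axis i (- 1)" for i
    by (auto simp: vec_eq_iff axis_def)
  have inj: "inj_on (\<lambda>(i, s). x + axis i s) (UNIV \<times> {1, -1 :: int})"
    by (auto simp: inj_on_def axis_eq_axis)
  have "x \<notin> (\<lambda>(i, s). x + axis i s) ` (UNIV \<times> {1, -1})"
    by (auto simp: axis_eq_0_iff)
  then have "sum g (neighbours x) = g x + sum g ((\<lambda>(i, s). x + axis i s) ` (UNIV \<times> {1, -1}))"
    unfolding neighbours_eq by (subst sum.insert) auto
  also have "sum g ((\<lambda>(i, s). x + axis i s) ` (UNIV \<times> {1, -1}))
      = (\<Sum>i\<in>UNIV. \<Sum>s\<in>{1, -1}. g (x + axis i s))"
    by (subst sum.reindex[OF inj], subst sum.cartesian_product)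
      (rule sum.cong, auto)
  finally show ?thesis
    by (simp add: neg)
qed

lemma card_neighbours: "card (neighbours (x :: int ^ 'd)) = 2 * CARD('d) + 1"
  unfolding card_eq_sum sum_neighbours by simp

text \<open>The \<open>k\<close>-step transition probability from \<open>0\<close> to
  \<open>x\<close>, defined without the path measure; \<open>nn_integral_walk_heat\<close> links the
  two.\<close>

primrec heat :: "nat \<Rightarrow> int ^ 'd \<Rightarrow> real" where
  "heat 0 x = of_bool (x = 0)"
| "heat (Suc k) x = (\<Sum>y\<in>neighbours x. heat k y) / (2 * CARD('d) + 1)"

lemma heat_nonneg: "heat k x \<ge> 0"
  by (induction k arbitrary: x) (auto intro!: divide_nonneg_nonneg sum_nonneg)

text \<open>The neighbour sum splits into sums of \<open>heat k\<close> over \<open>A\<close> and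
  over its translates by signed unit vectors, so \<open>A\<close> stays arbitrary in the
  induction.\<close>

lemma sum_heat_le_1: "finite A \<Longrightarrow> (\<Sum>x\<in>A. heat k (x :: int ^ 'd)) \<le> 1"
proof (induction k arbitrary: A)
  case 0
  then show ?case
    by (simp add: of_bool_def)
next
  case (Suc k)
  have shift: "(\<Sum>x\<in>A. heat k (x + e)) \<le> 1" for e
  proof -
    have "(\<Sum>x\<in>A. heat k (x + e)) = (\<Sum>x\<in>(\<lambda>x. x + e) ` A. heat k x)"
      by (subst sum.reindex) auto
    also have "\<dots> \<le> 1"
      using Suc by (intro Suc.IH) auto
    finally show ?thesis .
  qed
  have "(\<Sum>x\<in>A. \<Sum>y\<in>neighbours x. heat k y)
      = (\<Sum>x\<in>A. heat k x) + (\<Sum>i\<in>UNIV. (\<Sum>x\<in>A. heat k (x + axis i 1)) + (\<Sum>x\<in>A. heat k (x + - axis i 1)))"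
    unfolding sum_neighbours sum.distrib by (simp add: sum.swap[of _ A UNIV])
  also have "\<dots> \<le> 1 + (\<Sum>i\<in>(UNIV :: 'd set). 1 + 1)"
    by (intro add_mono sum_mono shift Suc)
  also have "\<dots> = 2 * CARD('d) + 1"
    by simp
  finally show ?case
    by (simp add: sum_divide_distrib[symmetric] divide_le_eq)
qed

section \<open>Finite Fourier analysis and the decay of the heat kernel\<close>

lemma one_minus_cos_ge:
  assumes "\<bar>x\<bar> \<le> pi"
  shows "x\<^sup>2 / 32 \<le> 1 - cos (x :: real)"
proof -
  \<comment> \<open>By the double angle formula \<open>1 - cos x = 2 * (sin (2 * y))\<^sup>2\<close>
    and \<open>sin (2 * y) = 2 * sin y * cos y\<close>. On the range of \<open>y\<close> the cosine
    is at least \<open>1 / 2\<close>, which by the mean value theorem also bounds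
    \<open>sin y\<close> below by \<open>y / 2\<close>.\<close>
  define y where "y = \<bar>x\<bar> / 4"
  have y: "0 \<le> y" "y \<le> pi / 4"
    using assms by (auto simp: y_def)
  have half: "1 / 2 \<le> cos t" if "0 \<le> t" "t \<le> pi / 4" for t
    using that cos_monotone_0_pi_le[of t "pi / 3"] by (simp add: cos_60)
  have "y / 2 \<le> sin y"
  proof (cases "y = 0")
    case False
    then obtain t where "0 < t" "t < y" "sin y - sin 0 = (y - 0) * cos t"
      using MVT2[of 0 y sin cos] y by (auto intro: DERIV_sin)
    then show ?thesis
      using half[of t] y mult_left_mono[of "1 / 2" "cos t" y] by auto
  qed simp
  then have "y / 2 * (1 / 2) \<le> sin y * cos y"
    using half[OF y] y by (intro mult_mono) auto
  then have "y / 2 \<le> sin (2 * y)"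
    by (simp add: sin_double)
  then have "(y / 2)\<^sup>2 \<le> (sin (2 * y))\<^sup>2"
    using y by (intro power_mono) auto
  moreover have "cos (2 * (2 * y)) = 1 - 2 * (sin (2 * y))\<^sup>2"
    by (rule cos_double_sin)
  moreover have "cos (2 * (2 * y)) = cos x"
    by (simp add: y_def)
  ultimately show ?thesis
    by (simp add: y_def power_divide)
qed

lemma cis_sum: "cis (\<Sum>i\<in>A. g i) = (\<Prod>i\<in>A. cis (g i))"
  by (induction A rule: infinite_finite_induct) (auto simp flip: cis_mult)

text \<open>A geometric sum of powers of a root of unity \<open>w\<close>: it vanishes unless
  \<open>w = 1\<close>. The sign and the value at \<open>0\<close> feed the base case of
  \<open>heat_le_fourier\<close>.\<close>

lemma sum_cis_roots:
  fixes m :: nat and x :: int and \<alpha> :: real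
  defines "\<alpha> \<equiv> 2 * pi / (2 * m + 1)"
  shows "\<exists>r :: real \<ge> 0. (\<Sum>j\<in>{- int m..int m}. cis (\<alpha> * j * x)) = of_real r \<and> (x = 0 \<longrightarrow> r = 2 * m + 1)"
proof -
  define w where "w = cis (\<alpha> * x)"
  have N: "w ^ (2 * m + 1) = 1"
  proof -
    have "(2 * m + 1) * (\<alpha> * x) = 2 * pi * x"
      by (simp add: \<alpha>_def field_simps)
    then have "w ^ (2 * m + 1) = cis (2 * pi * x)"
      unfolding w_def Complex.DeMoivre by (simp only:)
    then show ?thesis
      by (simp add: cis_multiple_2pi)
  qed
  have "(\<Sum>j\<in>{- int m..int m}. cis (\<alpha> * j * x)) = (\<Sum>i<2 * m + 1. cis (\<alpha> * (int i - int m) * x))"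
    by (rule sum.reindex_bij_witness[of _ "\<lambda>i. int i - int m" "\<lambda>j. nat (j + int m)"]) auto
  also have "\<dots> = (\<Sum>i<2 * m + 1. inverse (w ^ m) * w ^ i)"
    unfolding w_def Complex.DeMoivre cis_inverse cis_mult
    by (intro sum.cong refl arg_cong[of _ _ cis]) (simp add: algebra_simps)
  also have "\<dots> = inverse (w ^ m) * (\<Sum>i<2 * m + 1. w ^ i)"
    by (simp only: sum_distrib_left)
  finally have eq: "(\<Sum>j\<in>{- int m..int m}. cis (\<alpha> * j * x)) = inverse (w ^ m) * (\<Sum>i<2 * m + 1. w ^ i)" .
  show ?thesis
  proof (cases "w = 1")
    case True
    then show ?thesis
      unfolding eq by (intro exI[of _ "2 * real m + 1"]) simp
  next
    case False
    then have "x \<noteq> 0"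
      by (auto simp: w_def)
    moreover have "(\<Sum>i<2 * m + 1. w ^ i) = 0"
      using geometric_sum[OF False, of "2 * m + 1"] N by simp
    ultimately show ?thesis
      unfolding eq by (intro exI[of _ 0]) auto
  qed
qed

definition frequencies :: "nat \<Rightarrow> ('d \<Rightarrow> int) set" where
  "frequencies m = (\<Pi>\<^sub>E i\<in>UNIV. {- int m..int m})"

text \<open>The characteristic function of one step at the frequency \<open>\<alpha> * f\<close>,
  real because the step law is symmetric.\<close>

definition char_fun :: "real \<Rightarrow> ('d :: finite \<Rightarrow> int) \<Rightarrow> real" where
  "char_fun \<alpha> f = (1 + 2 * (\<Sum>i\<in>UNIV. cos (\<alpha> * f i))) / (2 * CARD('d) + 1)"

text \<open>The right-hand side is the heat kernel of the walk on the torus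
  \<open>(\<int>/(2m+1)\<int>)\<^sup>d\<close>, written as a finite Fourier sum; projecting to the torus can only
  increase transition probabilities.\<close>

lemma heat_le_fourier:
  fixes x :: "int ^ 'd" and m :: nat and \<alpha> :: real
  defines "\<alpha> \<equiv> 2 * pi / (2 * m + 1)"
  shows "heat k x \<le> (\<Sum>f\<in>frequencies m. char_fun \<alpha> f ^ k * cos (\<alpha> * (\<Sum>i\<in>UNIV. f i * x $ i)))
      / (2 * m + 1) ^ CARD('d)"
proof (induction k arbitrary: x)
  case 0
  \<comment> \<open>At time \<open>0\<close> the Fourier sum factorises over coordinates into root
    sums, which are nonnegative and equal \<open>2 * m + 1\<close> at \<open>0\<close>. Only here
    does an inequality replace an identity.\<close>
  define r where "r x = Re (\<Sum>j\<in>{- int m..int m}. cis (\<alpha> * j * x))" for x :: int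
  have r: "r x \<ge> 0" "(\<Sum>j\<in>{- int m..int m}. cis (\<alpha> * j * x)) = of_real (r x)"
      "x = 0 \<Longrightarrow> r x = 2 * m + 1" for x :: int
  proof -
    obtain s :: real where s: "s \<ge> 0" "(\<Sum>j\<in>{- int m..int m}. cis (\<alpha> * j * x)) = of_real s"
        "x = 0 \<longrightarrow> s = 2 * m + 1"
      using sum_cis_roots[of m x] unfolding \<alpha>_def[symmetric] by blast
    then have "r x = s"
      by (simp only: r_def Re_complex_of_real)
    then show "r x \<ge> 0" "(\<Sum>j\<in>{- int m..int m}. cis (\<alpha> * j * x)) = of_real (r x)"
        "x = 0 \<Longrightarrow> r x = 2 * m + 1"
      using s by simp_all
  qed
  have cis_eq: "cis (\<alpha> * (\<Sum>i\<in>UNIV. f i * x $ i)) = (\<Prod>i\<in>UNIV. cis (\<alpha> * f i * x $ i))" for f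
    using cis_sum[of "\<lambda>i. \<alpha> * f i * x $ i" UNIV] by (simp add: sum_distrib_left mult.assoc)
  have "(\<Sum>f\<in>frequencies m. cis (\<alpha> * (\<Sum>i\<in>UNIV. f i * x $ i))) = (\<Prod>i\<in>UNIV. of_real (r (x $ i)))"
    unfolding cis_eq frequencies_def by (subst prod_sum_PiE[symmetric]) (simp_all add: r)
  then have "Re (\<Sum>f\<in>frequencies m. cis (\<alpha> * (\<Sum>i\<in>UNIV. f i * x $ i))) = Re (of_real (\<Prod>i\<in>UNIV. r (x $ i)))"
    by (simp only: of_real_prod)
  then have "(\<Sum>f\<in>frequencies m. cos (\<alpha> * (\<Sum>i\<in>UNIV. f i * x $ i))) = (\<Prod>i\<in>UNIV. r (x $ i))"
    by (simp only: Re_sum cis.sel Re_complex_of_real)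
  moreover have "(\<Prod>i\<in>UNIV. r (x $ i)) \<ge> 0"
    by (intro prod_nonneg ballI r)
  moreover have "x = 0 \<Longrightarrow> (\<Prod>i\<in>UNIV. r (x $ i)) = (2 * m + 1) ^ CARD('d)"
    using r(3)[of 0] by simp
  ultimately show ?case
    by (auto simp: add.commute)
next
  case (Suc k)
  \<comment> \<open>Cosines are eigenfunctions of summation over neighbours.\<close>
  have step: "(\<Sum>y\<in>neighbours x. cos (\<alpha> * (\<Sum>i\<in>UNIV. f i * y $ i)))
      = (2 * CARD('d) + 1) * char_fun \<alpha> f * cos (\<alpha> * (\<Sum>i\<in>UNIV. f i * x $ i))" for f
  proof -
    define a where "a = \<alpha> * (\<Sum>i\<in>UNIV. f i * x $ i)"
    have axis: "(\<Sum>i\<in>UNIV. f i * axis j 1 $ i) = f j" for j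
      by (simp add: axis_def if_distrib[of "(*) (f _)"] cong: if_cong)
    have plus: "\<alpha> * (\<Sum>i\<in>UNIV. f i * (x + axis j 1) $ i) = a + \<alpha> * f j" for j
      by (simp only: vector_add_component distrib_left sum.distrib axis a_def of_int_add)
    have minus: "\<alpha> * (\<Sum>i\<in>UNIV. f i * (x - axis j 1) $ i) = a - \<alpha> * f j" for j
      by (simp only: vector_minus_component right_diff_distrib sum_subtractf axis a_def of_int_diff)
    have "0 < 2 * real CARD('d) + 1"
      by (simp add: add_nonneg_pos)
    then have "(2 * CARD('d) + 1) * char_fun \<alpha> f = 1 + 2 * (\<Sum>i\<in>UNIV. cos (\<alpha> * f i))"
      unfolding char_fun_def by simp
    moreover have "cos (a + b) + cos (a - b) = cos a * (2 * cos b)" for b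
      by (simp add: cos_add cos_diff)
    then have "(\<Sum>y\<in>neighbours x. cos (\<alpha> * (\<Sum>i\<in>UNIV. f i * y $ i)))
        = cos a * (1 + 2 * (\<Sum>i\<in>UNIV. cos (\<alpha> * f i)))"
      unfolding sum_neighbours plus minus a_def[symmetric] by (simp only: sum_distrib_left distrib_left mult_1_right)
    ultimately show ?thesis
      unfolding a_def[symmetric] by (simp only: mult.commute)
  qed
  have "heat (Suc k) x \<le> (\<Sum>y\<in>neighbours x.
      (\<Sum>f\<in>frequencies m. char_fun \<alpha> f ^ k * cos (\<alpha> * (\<Sum>i\<in>UNIV. f i * y $ i))) / (2 * m + 1) ^ CARD('d))
      / (2 * CARD('d) + 1)"
    unfolding heat.simps by (intro divide_right_mono sum_mono Suc.IH) auto
  also have "\<dots> = (\<Sum>f\<in>frequencies m. char_fun \<alpha> f ^ k *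
      (\<Sum>y\<in>neighbours x. cos (\<alpha> * (\<Sum>i\<in>UNIV. f i * y $ i)))) / (2 * m + 1) ^ CARD('d) / (2 * CARD('d) + 1)"
    by (simp only: sum_divide_distrib[symmetric] sum_distrib_left sum.swap[of _ "neighbours x"])
  also have "\<dots> = (\<Sum>f\<in>frequencies m. char_fun \<alpha> f ^ Suc k * cos (\<alpha> * (\<Sum>i\<in>UNIV. f i * x $ i)))
      / (2 * m + 1) ^ CARD('d)"
  proof -
    have "X * (D * y * z) / N / D = y * X * z / N" if "D \<noteq> 0" for X D y z N :: real
      using that by simp
    then show ?thesis
      unfolding step sum_divide_distrib power_Suc
      by (intro sum.cong refl) (simp_all only: of_nat_eq_0_iff add_is_0 one_neq_zero simp_thms)
  qed
  finally show ?case .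
qed

text \<open>The upper side is the quadratic cosine bound. The lower side rests on the possibility of
  staying put: the numerator is at least \<open>1 - 2 * D\<close>, which leaves a gap of
  \<open>2\<close> above \<open>- (2 * D + 1)\<close>, while the deficit \<open>q / (32 * D)\<close>
  is at most \<open>1\<close>.\<close>

lemma abs_char_fun_le:
  fixes f :: "'d :: finite \<Rightarrow> int" and c \<alpha> :: real
  defines "c \<equiv> 1 / (32 * real CARD('d) * (2 * real CARD('d) + 1))"
  assumes "\<And>i. \<bar>\<alpha> * f i\<bar> \<le> pi"
  shows "\<bar>char_fun \<alpha> f\<bar> \<le> exp (- c * (\<Sum>i\<in>UNIV. (\<alpha> * f i)\<^sup>2))"
proof -
  define D where "D = real CARD('d)"
  define q where "q = (\<Sum>i\<in>UNIV. (\<alpha> * f i)\<^sup>2)"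
  have D: "D \<ge> 1"
    by (simp add: D_def Suc_leI)
  have q0: "q \<ge> 0"
    unfolding q_def by (intro sum_nonneg) auto
  have cs: "c * (2 * D + 1) = 1 / (32 * D)"
  proof -
    have "c = 1 / (32 * D * (2 * D + 1))"
      by (simp add: c_def D_def)
    then have "c * (2 * D + 1) = 1 / (32 * D * (2 * D + 1)) * (2 * D + 1)"
      by simp
    also have "\<dots> = 1 / (32 * D)"
      using D by (simp del: distrib_left_numeral)
    finally show ?thesis .
  qed
  have "(\<Sum>i\<in>UNIV. (\<alpha> * f i)\<^sup>2 / 32) \<le> (\<Sum>i\<in>UNIV. 1 - cos (\<alpha> * f i))"
    using assms by (intro sum_mono one_minus_cos_ge)
  then have "q / 32 \<le> D - (\<Sum>i\<in>UNIV. cos (\<alpha> * f i))"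
    by (simp add: q_def D_def sum_subtractf sum_divide_distrib)
  moreover have "q / (32 * D) \<le> q / 32"
    using q0 D by (intro divide_left_mono) auto
  ultimately have up: "(1 + 2 * (\<Sum>i\<in>UNIV. cos (\<alpha> * f i))) \<le> 2 * D + 1 - q / (32 * D)"
    using q0 D by linarith
  have "q \<le> (\<Sum>i\<in>(UNIV :: 'd set). 4\<^sup>2)"
    unfolding q_def
  proof (rule sum_mono)
    fix i
    have "\<bar>\<alpha> * f i\<bar> \<le> \<bar>4\<bar>"
      using assms(2)[of i] pi_less_4 by linarith
    then show "(\<alpha> * f i)\<^sup>2 \<le> 4\<^sup>2"
      by (simp only: abs_le_square_iff)
  qed
  then have "q / (32 * D) \<le> 1"
    using D by (simp add: D_def divide_le_eq)
  moreover have "(\<Sum>i\<in>(UNIV :: 'd set). -1) \<le> (\<Sum>i\<in>UNIV. cos (\<alpha> * f i))"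
    by (intro sum_mono) auto
  then have "- D \<le> (\<Sum>i\<in>UNIV. cos (\<alpha> * f i))"
    by (simp add: D_def)
  ultimately have lo: "- (1 + 2 * (\<Sum>i\<in>UNIV. cos (\<alpha> * f i))) \<le> 2 * D + 1 - q / (32 * D)"
    by linarith
  have "\<bar>1 + 2 * (\<Sum>i\<in>UNIV. cos (\<alpha> * f i))\<bar> \<le> 2 * D + 1 - q / (32 * D)"
    using up lo by linarith
  also have "\<dots> = (1 - c * q) * (2 * D + 1)"
  proof -
    have "q / (32 * D) = c * (2 * D + 1) * q"
      by (simp only: cs) simp
    then show ?thesis
      by (simp add: algebra_simps)
  qed
  finally have "\<bar>char_fun \<alpha> f\<bar> \<le> 1 - c * q"
    using D unfolding char_fun_def by (simp add: abs_divide divide_le_eq D_def add.commute)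
  also have "\<dots> \<le> exp (- c * q)"
    using exp_ge_add_one_self[of "- c * q"] by simp
  finally show ?thesis
    by (simp add: q_def)
qed

text \<open>The square of an integer is at least its absolute value, so two geometric series, one
  for each sign, dominate the sum.\<close>

lemma sum_exp_neg_square_le:
  assumes "a > 0"
  shows "(\<Sum>j\<in>{- int m..int m}. exp (- a * (real_of_int j)\<^sup>2)) \<le> 2 / (1 - exp (- a))"
proof -
  have less1: "exp (- a) < 1"
    using assms by simp
  have "(\<Sum>j\<in>{- int m..int m}. exp (- a * (real_of_int j)\<^sup>2))
      \<le> (\<Sum>j\<in>{- int m..int m}. exp (- a) ^ nat \<bar>j\<bar>)"
  proof (rule sum_mono)
    fix j :: int
    have "\<bar>j\<bar> ^ 1 \<le> \<bar>j\<bar> ^ 2"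
    proof (cases "j = 0")
      case False
      then show ?thesis
        by (intro power_increasing) auto
    qed simp
    then have "real_of_int \<bar>j\<bar> \<le> (real_of_int j)\<^sup>2"
      unfolding of_int_power[symmetric] of_int_le_iff by simp
    then have "- a * (real_of_int j)\<^sup>2 \<le> real (nat \<bar>j\<bar>) * - a"
      using assms by simp
    then show "exp (- a * (real_of_int j)\<^sup>2) \<le> exp (- a) ^ nat \<bar>j\<bar>"
      unfolding exp_of_nat_mult[symmetric] by simp
  qed
  also have "\<dots> \<le> (\<Sum>j\<in>int ` {..m} \<union> (\<lambda>i. - int i) ` {..m}. exp (- a) ^ nat \<bar>j\<bar>)"
  proof (rule sum_mono2)
    show "{- int m..int m} \<subseteq> int ` {..m} \<union> (\<lambda>i. - int i) ` {..m}"
    proof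
      fix j assume "j \<in> {- int m..int m}"
      then show "j \<in> int ` {..m} \<union> (\<lambda>i. - int i) ` {..m}"
        by (cases j rule: int_cases2) auto
    qed
  qed auto
  also have "\<dots> \<le> (\<Sum>j\<in>int ` {..m}. exp (- a) ^ nat \<bar>j\<bar>) + (\<Sum>j\<in>(\<lambda>i. - int i) ` {..m}. exp (- a) ^ nat \<bar>j\<bar>)"
    by (subst sum.union_inter[symmetric]) (auto intro!: sum_nonneg)
  also have "\<dots> = 2 * (\<Sum>i\<le>m. exp (- a) ^ i)"
    by (subst (1 2) sum.reindex) (auto simp: inj_on_def)
  also have "(\<Sum>i\<le>m. exp (- a) ^ i) \<le> (\<Sum>i. exp (- a) ^ i)"
    using less1 by (intro sum_le_suminf summable_geometric) auto
  also have "\<dots> = 1 / (1 - exp (- a))"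
    using less1 by (intro suminf_geometric) auto
  finally show ?thesis
    by simp
qed

text \<open>The torus side \<open>2 * m + 1\<close> is chosen of order \<open>sqrt k\<close>. Then
  the Fourier sum is at most \<open>B ^ d\<close> whatever \<open>k\<close> is, and the
  normalisation by the volume of the torus supplies the decay. Writing \<open>Suc k\<close> includes
  time \<open>0\<close>.\<close>

lemma heat_kernel_bound:
  "\<exists>C \<ge> 1. \<forall>k (x :: int ^ 'd). heat k x \<le> C * real (Suc k) powr (- (CARD('d) / 2))"
proof -
  define d where "d = CARD('d)"
  define c where "c = 1 / (32 * real d * (2 * real d + 1))"
  define B where "B = 2 / (1 - exp (- (4 * c)))"
  have "d > 0"
    by (simp add: d_def)
  then have c: "c > 0"
    by (simp add: c_def)
  have B: "B \<ge> 2"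
    using c by (simp add: B_def le_divide_eq)
  define C where "C = (B * sqrt 2) ^ d"
  have "1 \<le> B * sqrt 2"
    using B mult_mono[of 1 B 1 "sqrt 2"] by auto
  then have C: "C \<ge> 1"
    unfolding C_def by (rule one_le_power)
  have "heat k x \<le> C * real (Suc k) powr (- (d / 2))" for k and x :: "int ^ 'd"
  proof (cases "k = 0")
    case True
    then show ?thesis
      using C by simp
  next
    case False
    define m where "m = nat \<lfloor>sqrt k\<rfloor>"
    define \<alpha> where "\<alpha> = 2 * pi / (2 * m + 1)"
    have "sqrt k \<ge> 1"
      using False by simp
    then have m: "m \<ge> 1" "real m \<le> sqrt k" "sqrt k < real m + 1"
      unfolding m_def by (auto simp: le_nat_floor)
    have "(2 * real m + 1)\<^sup>2 \<le> (3 * sqrt k)\<^sup>2"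
      using m by (intro power_mono) auto
    then have Nk: "(2 * real m + 1)\<^sup>2 \<le> 9 * k"
      by (simp add: power_mult_distrib)
    \<comment> \<open>The numerator \<open>36\<close> against a squared side of at most
      \<open>9 * k\<close> gives the constant \<open>4\<close>.\<close>
    have "36 \<le> (2 * pi)\<^sup>2"
      using power_mono[of 6 "2 * pi" 2] pi_gt3 by simp
    then have k\<alpha>: "4 \<le> k * \<alpha>\<^sup>2"
    proof -
      have "4 * (2 * real m + 1)\<^sup>2 \<le> k * (2 * pi)\<^sup>2"
        using Nk mult_left_mono[OF \<open>36 \<le> (2 * pi)\<^sup>2\<close>, of "real k"] by simp
      then show ?thesis
        by (simp add: \<alpha>_def power_divide le_divide_eq add.commute)
    qed
    \<comment> \<open>Centring the frequencies at \<open>0\<close> keeps every angle in the range of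
      the quadratic cosine bound.\<close>
    have small: "\<bar>\<alpha> * f i\<bar> \<le> pi" if "f \<in> frequencies m" for f and i :: 'd
    proof -
      have "\<bar>f i\<bar> \<le> int m"
        using PiE_mem[OF that[unfolded frequencies_def], of i] by auto
      then have "\<bar>real_of_int (f i)\<bar> \<le> m"
        by linarith
      then have "2 * \<bar>real_of_int (f i)\<bar> \<le> 2 * m + 1"
        by linarith
      then have "pi * (2 * \<bar>real_of_int (f i)\<bar>) \<le> pi * (2 * m + 1)"
        by (intro mult_left_mono) auto
      then show ?thesis
        by (simp add: \<alpha>_def abs_mult divide_le_eq algebra_simps)
    qed
    have term_le: "char_fun \<alpha> f ^ k * cos (\<alpha> * (\<Sum>i\<in>UNIV. f i * x $ i)) \<le> (\<Prod>i\<in>UNIV. exp (- (4 * c) * (real_of_int (f i))\<^sup>2))"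
      if "f \<in> frequencies m" for f
    proof -
      have "char_fun \<alpha> f ^ k * cos (\<alpha> * (\<Sum>i\<in>UNIV. f i * x $ i))
          \<le> \<bar>char_fun \<alpha> f ^ k\<bar> * \<bar>cos (\<alpha> * (\<Sum>i\<in>UNIV. f i * x $ i))\<bar>"
        by (metis abs_ge_self abs_mult)
      also have "\<dots> \<le> \<bar>char_fun \<alpha> f ^ k\<bar> * 1"
        by (intro mult_left_mono) auto
      also have "\<dots> = \<bar>char_fun \<alpha> f\<bar> ^ k"
        by (simp add: power_abs)
      also have "\<dots> \<le> exp (- c * (\<Sum>i\<in>UNIV. (\<alpha> * f i)\<^sup>2)) ^ k"
        using abs_char_fun_le[of \<alpha> f, OF small[OF that]] unfolding c_def d_def by (intro power_mono) auto
      also have "\<dots> = exp (- (c * (k * \<alpha>\<^sup>2)) * (\<Sum>i\<in>UNIV. (real_of_int (f i))\<^sup>2))"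
        unfolding exp_of_nat_mult[symmetric] by (simp add: sum_distrib_left power_mult_distrib sum_negf algebra_simps)
      also have "\<dots> \<le> exp (- (4 * c) * (\<Sum>i\<in>UNIV. (real_of_int (f i))\<^sup>2))"
      proof -
        have "(4 * c) * (\<Sum>i\<in>UNIV. (real_of_int (f i))\<^sup>2) \<le> (c * (k * \<alpha>\<^sup>2)) * (\<Sum>i\<in>UNIV. (real_of_int (f i))\<^sup>2)"
          using c k\<alpha> by (intro mult_right_mono sum_nonneg) auto
        then show ?thesis
          by simp
      qed
      also have "\<dots> = (\<Prod>i\<in>UNIV. exp (- (4 * c) * (real_of_int (f i))\<^sup>2))"
        by (simp add: exp_sum[symmetric] sum_distrib_left)
      finally show ?thesis .
    qed
    have N0: "sqrt k \<le> 2 * real m + 1"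
      using m by linarith
    have "heat k x \<le> (\<Sum>f\<in>frequencies m. char_fun \<alpha> f ^ k * cos (\<alpha> * (\<Sum>i\<in>UNIV. f i * x $ i))) / (2 * m + 1) ^ d"
      using heat_le_fourier[of k x m] by (simp add: \<alpha>_def d_def)
    also have "\<dots> \<le> (\<Sum>f\<in>(frequencies m :: ('d \<Rightarrow> int) set). \<Prod>i\<in>UNIV. exp (- (4 * c) * (real_of_int (f i))\<^sup>2)) / (2 * m + 1) ^ d"
      by (intro divide_right_mono sum_mono term_le) auto
    also have "\<dots> = (\<Sum>j\<in>{- int m..int m}. exp (- (4 * c) * (real_of_int j)\<^sup>2)) ^ d / (2 * m + 1) ^ d"
      unfolding frequencies_def by (subst prod_sum_PiE[symmetric]) (simp_all add: d_def)
    also have "\<dots> \<le> B ^ d / (2 * m + 1) ^ d"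
      unfolding B_def using c
      by (intro divide_right_mono power_mono sum_exp_neg_square_le sum_nonneg) auto
    also have "\<dots> \<le> B ^ d / sqrt k ^ d"
    proof -
      have "sqrt k ^ d \<le> real (2 * m + 1) ^ d"
        using N0 by (intro power_mono) auto
      moreover have "0 < real (2 * m + 1) ^ d" "0 < sqrt k ^ d" "0 \<le> B ^ d"
        using False B by auto
      ultimately show ?thesis
        by (intro divide_left_mono mult_pos_pos) (auto simp: add.commute)
    qed
    \<comment> \<open>Passing from \<open>k\<close> to \<open>Suc k\<close>, at most
      \<open>2 * k\<close>, costs the factor \<open>sqrt 2\<close> in each dimension that is built
      into \<open>C\<close>.\<close>
    also have "\<dots> \<le> B ^ d / (sqrt (Suc k) / sqrt 2) ^ d"
    proof -
      have "sqrt (Suc k) / sqrt 2 \<le> sqrt k"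
        unfolding real_sqrt_divide[symmetric] using False by simp
      then have "(sqrt (Suc k) / sqrt 2) ^ d \<le> sqrt k ^ d"
        by (intro power_mono) auto
      moreover have "0 < (sqrt (Suc k) / sqrt 2) ^ d" "0 < sqrt k ^ d" "0 \<le> B ^ d"
        using False B by auto
      ultimately show ?thesis
        by (intro divide_left_mono mult_pos_pos)
    qed
    also have "\<dots> = C / sqrt (Suc k) ^ d"
      by (simp add: C_def power_mult_distrib power_divide)
    also have "sqrt (Suc k) ^ d = Suc k powr (d / 2)"
    proof -
      have "(sqrt (Suc k)) ^ d = (Suc k powr (1 / 2)) powr d"
        by (simp only: powr_half_sqrt powr_realpow of_nat_0_less_iff zero_less_Suc of_nat_0_le_iff real_sqrt_gt_0_iff)
      then show ?thesis
        by (simp only: powr_powr) simp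
    qed
    finally show ?thesis
      by (simp only: powr_minus divide_inverse)
  qed
  with C show ?thesis
    unfolding d_def by blast
qed

section \<open>The Markov property\<close>

text \<open>A finite product of countable discrete spaces is discrete.\<close>

lemma borel_measurable_PiM_count_space:
  "finite J \<Longrightarrow> f \<in> borel_measurable (PiM J (\<lambda>_. count_space (UNIV :: 'a :: countable set)))"
  using count_space_PiM_finite[of J "\<lambda>_. UNIV :: 'a set"] by auto

text \<open>Stands in for measurability with respect to the positions up to time \<open>n\<close>:
  over a countable state space, dependence on these positions alone gives measurability
  (\<open>borel_measurable_adapted\<close>).\<close>

definition adapted :: "nat \<Rightarrow> ((nat \<Rightarrow> 'a) \<Rightarrow> 'b) \<Rightarrow> bool" where
  "adapted n h \<longleftrightarrow> (\<forall>S T. (\<forall>i\<le>n. S i = T i) \<longrightarrow> h S = h T)"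

lemma adaptedD: "adapted n h \<Longrightarrow> (\<And>i. i \<le> n \<Longrightarrow> S i = T i) \<Longrightarrow> h S = h T"
  by (auto simp: adapted_def)

lemma adapted_mono: "adapted m h \<Longrightarrow> m \<le> n \<Longrightarrow> adapted n h"
  unfolding adapted_def by (meson order_trans)

lemma adapted_const [simp]: "adapted n (\<lambda>_. c)"
  by (simp add: adapted_def)

lemma adapted_coord: "i \<le> n \<Longrightarrow> adapted n (\<lambda>S. f (S i))"
  by (simp add: adapted_def)

lemma adapted_times:
  assumes "adapted n g" "adapted n h"
  shows "adapted n (\<lambda>S. g S * h S)"
  unfolding adapted_def using adaptedD[OF assms(1)] adaptedD[OF assms(2)] by metis

lemma adapted_restrict: "adapted n h \<Longrightarrow> h (restrict S {0..<Suc n}) = h S"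
  by (erule adaptedD) auto

lemma restrict_measurable_walk_law:
  "(\<lambda>S. restrict S J) \<in> walk_law \<rightarrow>\<^sub>M PiM J (\<lambda>_. count_space (UNIV :: (int ^ 'd) set))"
  unfolding measurable_cong_sets[OF sets_walk_law refl]
  by (intro measurable_restrict_subset) auto

lemma borel_measurable_adapted:
  fixes h :: "(nat \<Rightarrow> int ^ 'd) \<Rightarrow> ennreal"
  assumes "adapted n h"
  shows "h \<in> borel_measurable walk_law"
proof -
  have "h \<circ> (\<lambda>S. restrict S {0..<Suc n}) \<in> borel_measurable walk_law"
    by (rule measurable_comp[OF restrict_measurable_walk_law borel_measurable_PiM_count_space]) auto
  then show ?thesis
    by (simp only: comp_def adapted_restrict[OF assms])
qed


text \<open>The marginal of the path measure on the times \<open>0\<close> to \<open>n\<close> is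
  the finite composition of kernels, and an adapted function does not see the restriction to these
  times.\<close>

lemma nn_integral_walk_law_adapted:
  fixes h :: "(nat \<Rightarrow> int ^ 'd) \<Rightarrow> ennreal"
  assumes "adapted n h"
  shows "(\<integral>\<^sup>+S. h S \<partial>walk_law) = (\<integral>\<^sup>+S. h S \<partial>walk.C 0 (Suc n) (\<lambda>_. undefined))"
proof -
  let ?J = "{0..<Suc n}"
  have upto: "walk.up_to ?J = Suc n"
  proof (rule antisym)
    show "walk.up_to ?J \<le> Suc n"
      by (subst walk.up_to_iff) auto
    show "Suc n \<le> walk.up_to ?J"
      using walk.up_to_less[of ?J n] by simp
  qed
  have C_sets: "sets (walk.C 0 (Suc n) (\<lambda>_. undefined)) = sets (PiM ?J (\<lambda>_. count_space (UNIV :: (int ^ 'd) set)))"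
    using walk.sets_C[of "\<lambda>_. undefined" 0 "Suc n"] by simp
  have hJ: "h \<in> borel_measurable (PiM ?J (\<lambda>_. count_space (UNIV :: (int ^ 'd) set)))"
    by (rule borel_measurable_PiM_count_space) simp
  have "(\<integral>\<^sup>+S. h S \<partial>walk_law) = (\<integral>\<^sup>+S. h (restrict S ?J) \<partial>walk_law)"
    by (simp only: adapted_restrict[OF assms])
  also have "\<dots> = (\<integral>\<^sup>+S. h S \<partial>distr walk_law (PiM ?J (\<lambda>_. count_space UNIV)) (\<lambda>S. restrict S ?J))"
    by (subst nn_integral_distr[OF restrict_measurable_walk_law]) (simp_all add: hJ)
  also have "\<dots> = (\<integral>\<^sup>+S. h S \<partial>walk.CI ?J)"
    unfolding walk_law_def by (subst walk.distr_lim) auto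
  also have "\<dots> = (\<integral>\<^sup>+S. h (restrict S ?J) \<partial>walk.C 0 (Suc n) (\<lambda>_. undefined))"
  proof -
    have "(\<lambda>S. restrict S ?J) \<in> walk.C 0 (Suc n) (\<lambda>_. undefined) \<rightarrow>\<^sub>M PiM ?J (\<lambda>_. count_space (UNIV :: (int ^ 'd) set))"
      unfolding measurable_cong_sets[OF C_sets refl] by (rule measurable_restrict_subset) simp
    then show ?thesis
      unfolding walk.CI_def upto by (subst nn_integral_distr) (simp_all add: hJ)
  qed
  finally show ?thesis
    by (simp only: adapted_restrict[OF assms])
qed

lemma nn_integral_walk_C_Suc:
  fixes h :: "(nat \<Rightarrow> int ^ 'd) \<Rightarrow> ennreal"
  shows "(\<integral>\<^sup>+S. h S \<partial>walk.C 0 (Suc n) (\<lambda>_. undefined))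
    = (\<integral>\<^sup>+S. (\<integral>\<^sup>+y. h (S(n := y)) \<partial>walk_kernel n S) \<partial>walk.C 0 n (\<lambda>_. undefined))"
proof -
  have C_space: "space (walk.C 0 n (\<lambda>_. undefined)) = space (PiM {0..<n} (\<lambda>_. count_space (UNIV :: (int ^ 'd) set)))"
    using walk.space_C[of "\<lambda>_. undefined" 0 n] by simp
  have C_sets: "sets (walk.C 0 n (\<lambda>_. undefined)) = sets (PiM {0..<n} (\<lambda>_. count_space (UNIV :: (int ^ 'd) set)))"
    using walk.sets_C[of "\<lambda>_. undefined" 0 n] by simp
  have h: "h \<in> borel_measurable (PiM {0..<Suc n} (\<lambda>_. count_space (UNIV :: (int ^ 'd) set)))"
    by (rule borel_measurable_PiM_count_space) simp
  have "(\<integral>\<^sup>+S. h S \<partial>walk.C 0 (Suc n) (\<lambda>_. undefined))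
      = (\<integral>\<^sup>+S. (\<integral>\<^sup>+T. h T \<partial>walk.eP n S) \<partial>walk.C 0 n (\<lambda>_. undefined))"
    using walk.measurable_eP[of n]
    by (simp, subst nn_integral_bind[OF h]) (auto simp: measurable_cong_sets[OF C_sets refl])
  also have "\<dots> = (\<integral>\<^sup>+S. (\<integral>\<^sup>+y. h (S(n := y)) \<partial>walk_kernel n S) \<partial>walk.C 0 n (\<lambda>_. undefined))"
    by (intro nn_integral_cong walk.nn_integral_eP h) (simp add: C_space)
  finally show ?thesis .
qed

lemma nn_integral_walk_start:
  "(\<integral>\<^sup>+S. f (S 0) \<partial>(walk_law :: (nat \<Rightarrow> int ^ 'd) measure)) = f 0"
proof -
  have "adapted 0 (\<lambda>S :: nat \<Rightarrow> int ^ 'd. f (S 0))"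
    by (rule adapted_coord) simp
  then have "(\<integral>\<^sup>+S. f (S 0) \<partial>(walk_law :: (nat \<Rightarrow> int ^ 'd) measure))
      = (\<integral>\<^sup>+S. f (S 0) \<partial>walk.C 0 (Suc 0) (\<lambda>_. undefined))"
    by (rule nn_integral_walk_law_adapted)
  also have "\<dots> = (\<integral>\<^sup>+S. f 0 \<partial>walk.C 0 0 (\<lambda>_. undefined :: int ^ 'd))"
    unfolding nn_integral_walk_C_Suc by (simp add: walk_kernel_def nn_integral_return_pmf)
  also have "\<dots> = f 0"
    using walk.prob_space_C[of "\<lambda>_. undefined" 0 0] by (simp add: prob_space.emeasure_space_1)
  finally show ?thesis .
qed

text \<open>The one-step Markov property: the last coordinate is integrated out against its kernel,
  and \<open>h\<close> is constant in it.\<close>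

lemma nn_integral_walk_step:
  fixes h :: "(nat \<Rightarrow> int ^ 'd) \<Rightarrow> ennreal"
  assumes h: "adapted n h"
  shows "(\<integral>\<^sup>+S. h S * f (S (Suc n)) \<partial>walk_law)
    = (\<integral>\<^sup>+S. h S * ((\<Sum>y\<in>neighbours (S n). f y) / of_nat (2 * CARD('d) + 1)) \<partial>walk_law)"
proof -
  have "adapted (Suc n) (\<lambda>S. h S * f (S (Suc n)))"
    by (intro adapted_times adapted_coord adapted_mono[OF h]) auto
  then have "(\<integral>\<^sup>+S. h S * f (S (Suc n)) \<partial>walk_law)
      = (\<integral>\<^sup>+S. h S * f (S (Suc n)) \<partial>walk.C 0 (Suc (Suc n)) (\<lambda>_. undefined))"
    by (rule nn_integral_walk_law_adapted)
  also have "\<dots> = (\<integral>\<^sup>+S. (\<integral>\<^sup>+y. h S * f y \<partial>walk_kernel (Suc n) S) \<partial>walk.C 0 (Suc n) (\<lambda>_. undefined))"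
  proof -
    have "h (S(Suc n := y)) = h S" for S y
      by (rule adaptedD[OF h]) auto
    then show ?thesis
      unfolding nn_integral_walk_C_Suc by simp
  qed
  also have "\<dots> = (\<integral>\<^sup>+S. h S * ((\<Sum>y\<in>neighbours (S n). f y) / of_nat (2 * CARD('d) + 1)) \<partial>walk.C 0 (Suc n) (\<lambda>_. undefined))"
  proof (rule nn_integral_cong)
    fix S :: "nat \<Rightarrow> int ^ 'd"
    have "neighbours (S n) \<noteq> {}"
      using self_in_neighbours by blast
    then show "(\<integral>\<^sup>+y. h S * f y \<partial>walk_kernel (Suc n) S) = h S * ((\<Sum>y\<in>neighbours (S n). f y) / of_nat (2 * CARD('d) + 1))"
      by (simp add: walk_kernel_def nn_integral_cmult nn_integral_pmf_of_set finite_neighbours card_neighbours)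
  qed
  also have "\<dots> = (\<integral>\<^sup>+S. h S * ((\<Sum>y\<in>neighbours (S n). f y) / of_nat (2 * CARD('d) + 1)) \<partial>walk_law)"
    by (intro nn_integral_walk_law_adapted[symmetric] adapted_times adapted_coord h order_refl)
  finally show ?thesis .
qed

lemma neighbours_diff: "z \<in> neighbours x \<longleftrightarrow> y - z \<in> neighbours (y - x)"
proof -
  have "y - z - (y - x) = - (z - x)"
    by simp
  then have "l1_norm (y - z - (y - x)) = l1_norm (- (z - x))"
    by (simp only:)
  also have "\<dots> = l1_norm (z - x)"
    unfolding l1_norm_def uminus_vec_def vec_lambda_beta abs_minus_cancel ..
  finally show ?thesis
    by (simp only: neighbours_def mem_Collect_eq)
qed

text \<open>The Markov property at time \<open>n\<close>. The induction peels off the first of the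
  \<open>j\<close> steps, so its hypothesis is applied at time \<open>Suc n\<close>.\<close>

lemma nn_integral_walk_heat:
  fixes h :: "(nat \<Rightarrow> int ^ 'd) \<Rightarrow> ennreal"
  assumes "adapted n h"
  shows "(\<integral>\<^sup>+S. h S * of_bool (S (n + j) = y) \<partial>walk_law) = (\<integral>\<^sup>+S. h S * ennreal (heat j (y - S n)) \<partial>walk_law)"
  using assms
proof (induction j arbitrary: n)
  case 0
  then show ?case
    by (intro nn_integral_cong) auto
next
  case (Suc j)
  \<comment> \<open>The reflection \<open>z \<mapsto> y - z\<close> maps the neighbours of
    \<open>x\<close> onto those of \<open>y - x\<close> and turns the average into the recursion for
    \<open>heat\<close>.\<close>
  have step: "(\<Sum>z\<in>neighbours x. ennreal (heat j (y - z))) / of_nat (2 * CARD('d) + 1) = ennreal (heat (Suc j) (y - x))" for x :: "int ^ 'd"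
  proof -
    have "(\<Sum>z\<in>neighbours x. heat j (y - z)) = (\<Sum>z\<in>neighbours (y - x). heat j z)"
      by (rule sum.reindex_bij_witness[of _ "\<lambda>z. y - z" "\<lambda>z. y - z"]) (simp_all add: neighbours_diff[symmetric] neighbours_diff[of _ "y - x" y])
    moreover have "ennreal (2 * CARD('d) + 1) = of_nat (2 * CARD('d) + 1)"
      by (metis ennreal_of_nat_eq_real_of_nat)
    ultimately show ?thesis
      by (simp add: heat_nonneg sum_nonneg divide_ennreal[symmetric])
  qed
  have "(\<integral>\<^sup>+S. h S * of_bool (S (n + Suc j) = y) \<partial>walk_law)
      = (\<integral>\<^sup>+S. h S * ennreal (heat j (y - S (Suc n))) \<partial>walk_law)"
    using Suc.IH[of "Suc n"] adapted_mono[OF Suc.prems, of "Suc n"] by simp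
  also have "\<dots> = (\<integral>\<^sup>+S. h S * ((\<Sum>z\<in>neighbours (S n). ennreal (heat j (y - z))) / of_nat (2 * CARD('d) + 1)) \<partial>walk_law)"
    by (rule nn_integral_walk_step[OF Suc.prems])
  finally show ?case
    by (simp only: step)
qed

section \<open>Chains of visits\<close>

text \<open>Lists of sites are in reverse order of visit: the head is the site visited last, and the
  walk starts at \<open>0 = tip []\<close>. The quantity \<open>chain S zs t\<close> counts the weakly increasing sequences
  of times, the last of them \<open>t\<close>, at which \<open>S\<close> visits the sites of \<open>zs\<close>. Allowing equal times
  makes its expectation, summed over \<open>t\<close>, exactly a product of Green functions.\<close>

definition tip :: "'a :: zero list \<Rightarrow> 'a" where
  "tip zs = (case zs of [] \<Rightarrow> 0 | z # _ \<Rightarrow> z)"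

lemma tip_simps [simp]: "tip [] = 0" "tip (z # zs) = z"
  by (simp_all add: tip_def)

primrec path_prod :: "('a :: {zero, minus} \<Rightarrow> real) \<Rightarrow> 'a list \<Rightarrow> real" where
  "path_prod g [] = 1"
| "path_prod g (z # zs) = g (z - tip zs) * path_prod g zs"

primrec chain :: "(nat \<Rightarrow> 'a) \<Rightarrow> 'a list \<Rightarrow> nat \<Rightarrow> ennreal" where
  "chain S [] t = of_bool (t = 0)"
| "chain S (z # zs) t = of_bool (S t = z) * (\<Sum>s\<le>t. chain S zs s)"

lemma path_prod_nonneg: "(\<And>x. g x \<ge> 0) \<Longrightarrow> path_prod g zs \<ge> 0"
  by (induction zs) auto

text \<open>The site visited last is summed out first and contributes a factor of at most
  \<open>M\<close>, whatever site precedes it. This serves both for occupation times and for the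
  final sum over sets of sites.\<close>

lemma sum_path_prod_le:
  fixes g :: "'a :: ab_group_add \<Rightarrow> real"
  assumes "finite A" "\<And>x. g x \<ge> 0" "\<And>y. (\<Sum>z\<in>A. g (z - y)) \<le> M"
  shows "(\<Sum>zs | set zs \<subseteq> A \<and> length zs = k. path_prod g zs) \<le> M ^ k"
proof (induction k)
  case 0
  have "{zs. set zs \<subseteq> A \<and> length zs = 0} = {[]}"
    by auto
  then show ?case
    by simp
next
  case (Suc k)
  have M: "M \<ge> 0"
    using assms(3)[of 0] sum_nonneg[of A "\<lambda>z. g (z - 0)"] assms(2) by fastforce
  have "(\<Sum>zs | set zs \<subseteq> A \<and> length zs = Suc k. path_prod g zs)
      = (\<Sum>p\<in>{zs. set zs \<subseteq> A \<and> length zs = k} \<times> A. path_prod g (snd p # fst p))"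
    unfolding lists_length_Suc_eq by (subst sum.reindex) (auto simp: inj_on_def case_prod_beta)
  also have "\<dots> = (\<Sum>zs | set zs \<subseteq> A \<and> length zs = k. \<Sum>z\<in>A. g (z - tip zs) * path_prod g zs)"
    by (simp add: sum.cartesian_product case_prod_beta)
  also have "\<dots> \<le> (\<Sum>zs | set zs \<subseteq> A \<and> length zs = k. M * path_prod g zs)"
    unfolding sum_distrib_right[symmetric]
    by (intro sum_mono mult_right_mono assms path_prod_nonneg)
  also have "\<dots> = M * (\<Sum>zs | set zs \<subseteq> A \<and> length zs = k. path_prod g zs)"
    by (simp only: sum_distrib_left)
  also have "\<dots> \<le> M * M ^ k"
    by (intro mult_left_mono Suc M)
  finally show ?case
    by simp
qed

section \<open>Expected numbers of chains and products of Green functions\<close>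

lemma adapted_sum:
  "(\<And>i. i \<in> I \<Longrightarrow> adapted n (h i)) \<Longrightarrow> adapted n (\<lambda>S. \<Sum>i\<in>I. h i S)"
  unfolding adapted_def by (blast intro: sum.cong)

lemma adapted_chain: "adapted t (\<lambda>S. chain S zs t)"
proof (induction zs arbitrary: t)
  case (Cons z zs)
  have "adapted t (\<lambda>S. of_bool (S t = z) :: ennreal)"
    by (rule adapted_coord[of t t "\<lambda>x. of_bool (x = z)"]) simp
  moreover have "adapted t (\<lambda>S. \<Sum>s\<le>t. chain S zs s)"
    by (intro adapted_sum adapted_mono[OF Cons.IH]) simp
  ultimately show ?case
    unfolding chain.simps by (rule adapted_times)
qed simp

lemma borel_measurable_chain: "(\<lambda>S. chain S zs t) \<in> borel_measurable walk_law"
  for zs :: "(int ^ 'd) list"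
  by (rule borel_measurable_adapted[OF adapted_chain])

lemma emeasure_walk_law_UNIV [simp]: "emeasure (walk_law :: (nat \<Rightarrow> int ^ 'd) measure) UNIV = 1"
  using walk_law.emeasure_space_1 by simp

text \<open>A chain ending at time \<open>t\<close> forces \<open>S t\<close> to be its last site;
  the empty chain forces \<open>t = 0\<close>, where the walk is at \<open>0\<close>.\<close>

lemma nn_integral_chain_tip:
  fixes zs :: "(int ^ 'd) list"
  shows "(\<integral>\<^sup>+S. chain S zs t * F (S t) \<partial>walk_law) = (\<integral>\<^sup>+S. chain S zs t \<partial>walk_law) * F (tip zs)"
proof (cases zs)
  case Nil
  show ?thesis
  proof (cases "t = 0")
    case True
    then show ?thesis
      by (simp add: Nil nn_integral_walk_start)
  qed (simp add: Nil)
next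
  case (Cons z ys)
  have "(\<integral>\<^sup>+S. chain S zs t * F (S t) \<partial>walk_law) = (\<integral>\<^sup>+S. chain S zs t * F z \<partial>walk_law)"
    by (intro nn_integral_cong) (auto simp: Cons)
  also have "\<dots> = (\<integral>\<^sup>+S. chain S zs t \<partial>walk_law) * F z"
    by (rule nn_integral_multc[OF borel_measurable_chain])
  finally show ?thesis
    by (simp only: Cons tip_simps)
qed

lemma nn_integral_chain_Cons:
  fixes zs :: "(int ^ 'd) list"
  shows "(\<integral>\<^sup>+S. chain S (z # zs) t \<partial>walk_law)
    = (\<Sum>s\<le>t. (\<integral>\<^sup>+S. chain S zs s \<partial>walk_law) * ennreal (heat (t - s) (z - tip zs)))"
proof -
  have [measurable]: "(\<lambda>S. chain S zs s * of_bool (S t = z)) \<in> borel_measurable walk_law" if "s \<le> t" for s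
    by (rule borel_measurable_adapted[of t])
      (intro adapted_times adapted_mono[OF adapted_chain that] adapted_coord[of t t "\<lambda>x. of_bool (x = z)"] order_refl)
  have "(\<integral>\<^sup>+S. chain S (z # zs) t \<partial>walk_law) = (\<integral>\<^sup>+S. (\<Sum>s\<le>t. chain S zs s * of_bool (S t = z)) \<partial>walk_law)"
    by (simp add: sum_distrib_right[symmetric] mult.commute)
  also have "\<dots> = (\<Sum>s\<le>t. \<integral>\<^sup>+S. chain S zs s * of_bool (S t = z) \<partial>walk_law)"
    by (rule nn_integral_sum) simp
  also have "\<dots> = (\<Sum>s\<le>t. (\<integral>\<^sup>+S. chain S zs s \<partial>walk_law) * ennreal (heat (t - s) (z - tip zs)))"
  proof (rule sum.cong[OF refl])
    fix s assume "s \<in> {..t}"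
    then have t: "s + (t - s) = t"
      by simp
    have "(\<integral>\<^sup>+S. chain S zs s * of_bool (S t = z) \<partial>walk_law)
        = (\<integral>\<^sup>+S. chain S zs s * ennreal (heat (t - s) (z - S s)) \<partial>walk_law)"
      using nn_integral_walk_heat[OF adapted_chain, of zs s "t - s" z] unfolding t .
    also have "\<dots> = (\<integral>\<^sup>+S. chain S zs s \<partial>walk_law) * ennreal (heat (t - s) (z - tip zs))"
      by (rule nn_integral_chain_tip)
    finally show "(\<integral>\<^sup>+S. chain S zs s * of_bool (S t = z) \<partial>walk_law)
        = (\<integral>\<^sup>+S. chain S zs s \<partial>walk_law) * ennreal (heat (t - s) (z - tip zs))" .
  qed
  finally show ?thesis .
qed

text \<open>The triangle of pairs with \<open>s + j < T\<close> lies in the square.\<close>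

lemma sum_convolution_le:
  fixes a b :: "nat \<Rightarrow> ennreal"
  shows "(\<Sum>t<T. \<Sum>s\<le>t. a s * b (t - s)) \<le> (\<Sum>s<T. a s) * (\<Sum>j<T. b j)"
proof -
  have "(\<Sum>t<T. \<Sum>s\<le>t. a s * b (t - s)) = (\<Sum>(s, j)\<in>{(s, j). s + j < T}. a s * b j)"
    by (rule sum.triangle_reindex[symmetric])
  also have "\<dots> \<le> (\<Sum>(s, j)\<in>{..<T} \<times> {..<T}. a s * b j)"
    by (rule sum_mono2) auto
  also have "\<dots> = (\<Sum>s<T. a s) * (\<Sum>j<T. b j)"
    by (simp only: sum_product sum.cartesian_product)
  finally show ?thesis .
qed

text \<open>The expected number of visits to \<open>z\<close>. A real \<open>suminf\<close> is
  meaningful only for a convergent series, whence the summability assumptions below.\<close>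

definition green :: "int ^ 'd \<Rightarrow> real" where
  "green z = (\<Sum>k. heat k z)"

lemma green_nonneg: "summable (\<lambda>k. heat k z) \<Longrightarrow> green z \<ge> 0"
  unfolding green_def by (intro suminf_nonneg heat_nonneg)

text \<open>Each further site convolves the expectation in time with the heat kernel; summing over
  time turns this into one factor \<open>green\<close>.\<close>

lemma sum_nn_integral_chain_le:
  fixes zs :: "(int ^ 'd) list"
  assumes summable: "\<And>z :: int ^ 'd. summable (\<lambda>k. heat k z)"
  shows "(\<Sum>t<T. \<integral>\<^sup>+S. chain S zs t \<partial>walk_law) \<le> ennreal (path_prod green zs)"
proof (induction zs)
  case Nil
  show ?case
    by (cases T) (simp_all add: sum.lessThan_Suc_shift del: sum.lessThan_Suc)
next
  case (Cons z zs)
  have "(\<Sum>t<T. \<integral>\<^sup>+S. chain S (z # zs) t \<partial>walk_law)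
      \<le> (\<Sum>s<T. \<integral>\<^sup>+S. chain S zs s \<partial>walk_law) * (\<Sum>j<T. ennreal (heat j (z - tip zs)))"
    unfolding nn_integral_chain_Cons by (rule sum_convolution_le)
  also have "\<dots> \<le> ennreal (path_prod green zs) * ennreal (green (z - tip zs))"
  proof (intro mult_mono Cons.IH)
    show "(\<Sum>j<T. ennreal (heat j (z - tip zs))) \<le> ennreal (green (z - tip zs))"
      unfolding green_def
      by (subst sum_ennreal) (auto intro!: ennreal_leI sum_le_suminf assms heat_nonneg)
  qed simp_all
  also have "\<dots> = ennreal (path_prod green (z # zs))"
    by (simp add: ennreal_mult[symmetric] path_prod_nonneg green_nonneg assms mult.commute)
  finally show ?case .
qed

lemma borel_measurable_suminf_chain: "(\<lambda>S. \<Sum>t. chain S zs t) \<in> borel_measurable walk_law"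
  for zs :: "(int ^ 'd) list"
  by (rule borel_measurable_suminf_order[OF borel_measurable_chain])

lemma nn_integral_suminf_chain_le:
  fixes zs :: "(int ^ 'd) list"
  assumes "\<And>z :: int ^ 'd. summable (\<lambda>k. heat k z)"
  shows "(\<integral>\<^sup>+S. (\<Sum>t. chain S zs t) \<partial>walk_law) \<le> ennreal (path_prod green zs)"
proof -
  have "(\<integral>\<^sup>+S. (\<Sum>t. chain S zs t) \<partial>walk_law) = (\<Sum>t. \<integral>\<^sup>+S. chain S zs t \<partial>walk_law)"
    by (rule nn_integral_suminf[OF borel_measurable_chain])
  also have "\<dots> \<le> ennreal (path_prod green zs)"
    unfolding suminf_eq_SUP by (intro SUP_least sum_nn_integral_chain_le assms)
  finally show ?thesis .
qed

text \<open>The sites are listed in the order of their first hitting times \<open>\<tau>\<close>.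
  The induction adds them in this order, with the invariant that the chain ends at the hitting time
  of the head.\<close>

lemma chain_of_visits:
  assumes "finite A" "\<And>z. z \<in> A \<Longrightarrow> \<exists>t. S t = z"
  shows "\<exists>zs. distinct zs \<and> set zs = A \<and> (\<Sum>t. chain S zs t) \<ge> 1"
proof -
  define \<tau> where "\<tau> z = (LEAST t. S t = z)" for z
  have \<tau>: "S (\<tau> z) = z" if "z \<in> A" for z
    using LeastI_ex[OF assms(2)[OF that]] by (simp only: \<tau>_def)
  have "\<exists>zs. distinct zs \<and> set zs = B \<and> (\<exists>t. chain S zs t \<ge> 1 \<and> t = (if zs = [] then 0 else \<tau> (hd zs)))"
    if "B \<subseteq> A" for B
    using finite_subset[OF that assms(1)] that
  proof (induction B rule: finite_ranking_induct[where f = \<tau>])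
    case empty
    show ?case
      by (rule exI[of _ "[]"]) simp
  next
    case (insert x B)
    have "B \<subseteq> A"
      using insert.prems by simp
    from insert.IH[OF this] obtain zs t where zs: "distinct zs" "set zs = B" "chain S zs t \<ge> 1" "t = (if zs = [] then 0 else \<tau> (hd zs))"
      by (elim exE conjE)
    have "t \<le> \<tau> x"
    proof (cases zs)
      case (Cons y ys)
      then have "y \<in> B"
        using zs(2) by auto
      then show ?thesis
        using insert.hyps(2)[of y] zs(4) Cons by simp
    qed (simp add: zs(4))
    then have "chain S zs t \<le> (\<Sum>s\<le>\<tau> x. chain S zs s)"
      by (intro member_le_sum) auto
    with zs(3) have "1 \<le> (\<Sum>s\<le>\<tau> x. chain S zs s)"
      by (rule order_trans)
    moreover have "S (\<tau> x) = x"
      using insert.prems by (intro \<tau>) simp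
    ultimately have chain: "1 \<le> chain S (x # zs) (\<tau> x)"
      by simp
    show ?case
    proof (cases "x \<in> B")
      case True
      then show ?thesis
        using zs unfolding insert_absorb[OF True] by (intro exI[of _ zs] conjI exI[of _ t])
    next
      case False
      then show ?thesis
        using zs(1,2) chain by (intro exI[of _ "x # zs"] conjI exI[of _ "\<tau> x"]) simp_all
    qed
  qed
  from this[OF order_refl] obtain zs t where "distinct zs" "set zs = A" "chain S zs t \<ge> 1"
    by (elim exE conjE)
  moreover have "(\<Sum>i\<in>{t}. chain S zs i) \<le> (\<Sum>i. chain S zs i)"
    by (rule sum_le_suminf) auto
  then have "chain S zs t \<le> (\<Sum>i. chain S zs i)"
    by simp
  ultimately show ?thesis
    using order_trans by blast
qed

section \<open>Counting the visits to a finite set by weakly increasing sequences of times\<close>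

definition chains_in :: "(nat \<Rightarrow> 'a) \<Rightarrow> 'a set \<Rightarrow> nat \<Rightarrow> nat \<Rightarrow> ennreal" where
  "chains_in S A k t = (\<Sum>zs | set zs \<subseteq> A \<and> length zs = k. chain S zs t)"

lemma chains_in_0: "chains_in S A 0 t = of_bool (t = 0)"
proof -
  have "{zs. set zs \<subseteq> A \<and> length zs = 0} = {[]}"
    by auto
  then show ?thesis
    by (simp add: chains_in_def)
qed

lemma chains_in_Suc:
  assumes "finite A"
  shows "chains_in S A (Suc k) t = of_bool (S t \<in> A) * (\<Sum>s\<le>t. chains_in S A k s)"
proof -
  have "chains_in S A (Suc k) t
      = (\<Sum>p\<in>{zs. set zs \<subseteq> A \<and> length zs = k} \<times> A. chain S (snd p # fst p) t)"
    unfolding chains_in_def lists_length_Suc_eq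
    by (subst sum.reindex) (auto simp: inj_on_def case_prod_beta)
  also have "\<dots> = (\<Sum>zs | set zs \<subseteq> A \<and> length zs = k. \<Sum>z\<in>A. of_bool (S t = z) * (\<Sum>s\<le>t. chain S zs s))"
    by (simp add: sum.cartesian_product case_prod_beta)
  also have "\<dots> = (\<Sum>zs | set zs \<subseteq> A \<and> length zs = k. of_bool (S t \<in> A) * (\<Sum>s\<le>t. chain S zs s))"
  proof (rule sum.cong[OF refl])
    fix zs
    have "(\<Sum>z\<in>A. of_bool (S t = z)) = (of_bool (S t \<in> A) :: ennreal)"
      using assms by (simp add: of_bool_def)
    then show "(\<Sum>z\<in>A. of_bool (S t = z) * (\<Sum>s\<le>t. chain S zs s)) = of_bool (S t \<in> A) * (\<Sum>s\<le>t. chain S zs s)"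
      by (simp only: sum_distrib_right[symmetric])
  qed
  also have "\<dots> = of_bool (S t \<in> A) * (\<Sum>s\<le>t. chains_in S A k s)"
    unfolding chains_in_def sum_distrib_left[symmetric] by (subst sum.swap) (rule refl)
  finally show ?thesis .
qed

text \<open>A \<open>k\<close>-subset of the visit times is a strictly increasing sequence, hence
  among the weakly increasing ones counted on the right. The induction on \<open>T\<close> follows
  Pascal's rule.\<close>

lemma binomial_le_chains_in:
  assumes "finite A"
  shows "of_nat (card {t. t \<le> T \<and> S t \<in> A} choose k) \<le> (\<Sum>t\<le>T. chains_in S A k t)"
proof (induction T arbitrary: k)
  case 0
  show ?case
  proof (cases k)
    case (Suc j)
    show ?thesis
    proof (cases "S 0 \<in> A")
      case True
      then have "{t. t \<le> 0 \<and> S t \<in> A} = {0}"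
        by auto
      then show ?thesis
        using True by (cases j) (auto simp: Suc chains_in_Suc[OF assms] chains_in_0)
    next
      case False
      then have none: "{t. t \<le> 0 \<and> S t \<in> A} = {}"
        by auto
      show ?thesis
        unfolding none Suc by (simp only: card.empty binomial_0_Suc of_nat_0 zero_le)
    qed
  qed (simp add: chains_in_0)
next
  case (Suc T)
  show ?case
  proof (cases k)
    case 0
    have "(\<Sum>t\<le>Suc T. chains_in S A 0 t) = 1"
      unfolding chains_in_0 by (simp add: sum.atMost_Suc_shift del: sum.atMost_Suc)
    then show ?thesis
      by (simp add: 0)
  next
    case (Suc j)
    show ?thesis
    proof (cases "S (Suc T) \<in> A")
      case True
      then have "{t. t \<le> Suc T \<and> S t \<in> A} = insert (Suc T) {t. t \<le> T \<and> S t \<in> A}"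
        by (auto simp: le_Suc_eq)
      then have card: "card {t. t \<le> Suc T \<and> S t \<in> A} = Suc (card {t. t \<le> T \<and> S t \<in> A})"
        by simp
      have "of_nat (card {t. t \<le> Suc T \<and> S t \<in> A} choose k)
          = (of_nat (card {t. t \<le> T \<and> S t \<in> A} choose Suc j) + of_nat (card {t. t \<le> T \<and> S t \<in> A} choose j) :: ennreal)"
        unfolding card Suc by simp
      also have "\<dots> \<le> (\<Sum>t\<le>T. chains_in S A (Suc j) t) + (\<Sum>t\<le>Suc T. chains_in S A j t)"
        by (intro add_mono Suc.IH order_trans[OF Suc.IH sum_mono2]) auto
      also have "\<dots> = (\<Sum>t\<le>Suc T. chains_in S A k t)"
        using True by (simp add: Suc chains_in_Suc[OF assms])
      finally show ?thesis .
    next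
      case False
      then have "{t. t \<le> Suc T \<and> S t \<in> A} = {t. t \<le> T \<and> S t \<in> A}"
        by (auto simp: le_Suc_eq)
      then show ?thesis
        using Suc.IH[of k] by (simp add: add_increasing2)
    qed
  qed
qed

lemma binomial_le_suminf_chains_in:
  assumes "finite A" "\<And>z. z \<in> A \<Longrightarrow> local_time S z = of_nat n"
  shows "of_nat (n * card A choose k) \<le> (\<Sum>t. chains_in S A k t)"
proof -
  define N where "N T = card {t. t \<le> T \<and> S t \<in> A}" for T
  have "(\<Sum>t. of_bool (S t \<in> A)) = (\<Sum>t. \<Sum>z\<in>A. of_bool (S t = z) :: ennreal)"
    using assms(1) by (intro suminf_cong) (simp add: of_bool_def)
  also have "\<dots> = (\<Sum>z\<in>A. local_time S z)"
    unfolding local_time_def by (rule suminf_sum) simp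
  also have "\<dots> = of_nat (n * card A)"
    using assms(2) by (simp add: mult.commute)
  finally have total: "(\<Sum>t. of_bool (S t \<in> A)) = (of_nat (n * card A) :: ennreal)" .
  have partial: "(\<Sum>t<T. of_bool (S t \<in> A)) \<le> (of_nat (N T) :: ennreal)" for T
  proof -
    have "(\<Sum>t<T. of_bool (S t \<in> A)) = (of_nat (card ({..<T} \<inter> {t. S t \<in> A})) :: ennreal)"
      by simp
    also have "\<dots> \<le> of_nat (N T)"
      unfolding N_def of_nat_le_iff by (intro card_mono) auto
    finally show ?thesis .
  qed
  \<comment> \<open>An integer count with the finite supremum \<open>n * card A\<close> attains it:
    otherwise every partial count, and hence the total, would be at most
    \<open>n * card A - 1\<close>.\<close>
  have "\<exists>T. n * card A \<le> N T"
  proof (rule ccontr)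
    assume "\<not> ?thesis"
    then have less: "N T < n * card A" for T
      by (simp add: not_le)
    have "N T \<le> n * card A - 1" for T
      using less[of T] by linarith
    then have "(\<Sum>t. of_bool (S t \<in> A)) \<le> (of_nat (n * card A - 1) :: ennreal)"
      unfolding suminf_eq_SUP
      by (intro SUP_least order_trans[OF partial]) simp
    then have "n * card A \<le> n * card A - 1"
      unfolding total of_nat_le_iff .
    then show False
      using less[of 0] by simp
  qed
  then obtain T where "n * card A \<le> N T" ..
  then have "(n * card A choose k) \<le> (N T choose k)"
    by (rule binomial_right_mono)
  then have "(of_nat (n * card A choose k) :: ennreal) \<le> of_nat (N T choose k)"
    by simp
  also have "\<dots> \<le> (\<Sum>t\<le>T. chains_in S A k t)"
    unfolding N_def by (rule binomial_le_chains_in[OF assms(1)])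
  also have "\<dots> \<le> (\<Sum>t. chains_in S A k t)"
    by (rule sum_le_suminf) auto
  finally show ?thesis .
qed

section \<open>Two bounds for the probability of prescribed local times\<close>

lemma borel_measurable_local_time:
  "(\<lambda>S. local_time S z) \<in> borel_measurable walk_law" for z :: "int ^ 'd"
  unfolding local_time_def
  by (rule borel_measurable_suminf_order, rule borel_measurable_adapted,
      rule adapted_coord[of _ _ "\<lambda>x. of_bool (x = z)"], rule order_refl)

lemma sets_local_time_eq:
  fixes A :: "(int ^ 'd) set"
  assumes "finite A"
  shows "{S. \<forall>z\<in>A. local_time S z = of_nat n} \<in> sets walk_law"
proof -
  note borel_measurable_local_time [measurable]
  have "{S \<in> space walk_law. \<forall>z\<in>A. local_time S z = of_nat n} \<in> sets walk_law"
    using assms by measurable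
  then show ?thesis
    by simp
qed

text \<open>Markov's inequality.\<close>

lemma measure_le_of_nn_integral:
  fixes f :: "'a \<Rightarrow> ennreal"
  assumes "prob_space M" "E \<in> sets M" "\<And>x. x \<in> E \<Longrightarrow> ennreal c \<le> f x" "integral\<^sup>N M f \<le> ennreal b" "0 \<le> b" "0 \<le> c"
  shows "c * measure M E \<le> b"
proof -
  interpret prob_space M by fact
  have "ennreal (c * measure M E) = (\<integral>\<^sup>+x. ennreal c * indicator E x \<partial>M)"
    using assms by (simp add: nn_integral_cmult_indicator emeasure_eq_measure ennreal_mult)
  also have "\<dots> \<le> integral\<^sup>N M f"
    using assms(3) by (intro nn_integral_mono) (auto split: split_indicator)
  also have "\<dots> \<le> ennreal b"
    by fact
  finally show ?thesis
    using assms by simp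
qed

text \<open>As \<open>n > 0\<close>, every site of \<open>A\<close> is visited, so some enumeration
  of \<open>A\<close> carries a chain; Markov's inequality is applied to the number of chains over
  all enumerations.\<close>

lemma measure_local_time_eq_le_permutations:
  fixes A :: "(int ^ 'd) set"
  assumes summable: "\<And>z :: int ^ 'd. summable (\<lambda>k. heat k z)"
    and A: "finite A" and n: "n > 0"
  shows "measure walk_law {S. \<forall>z\<in>A. local_time S z = of_nat n}
    \<le> (\<Sum>zs\<in>permutations_of_set A. path_prod green zs)"
proof -
  have "1 * measure walk_law {S. \<forall>z\<in>A. local_time S z = of_nat n}
      \<le> (\<Sum>zs\<in>permutations_of_set A. path_prod green zs)"
  proof (rule measure_le_of_nn_integral)
    show "prob_space (walk_law :: (nat \<Rightarrow> int ^ 'd) measure)"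
    by (rule walk_law.prob_space_axioms)
    show "{S. \<forall>z\<in>A. local_time S z = of_nat n} \<in> sets walk_law"
      by (rule sets_local_time_eq[OF A])
    show "0 \<le> (\<Sum>zs\<in>permutations_of_set A. path_prod green zs)"
      by (intro sum_nonneg path_prod_nonneg green_nonneg summable)
    have "(\<integral>\<^sup>+S. (\<Sum>zs\<in>permutations_of_set A. \<Sum>t. chain S zs t) \<partial>walk_law)
        = (\<Sum>zs\<in>permutations_of_set A. \<integral>\<^sup>+S. (\<Sum>t. chain S zs t) \<partial>walk_law)"
      by (intro nn_integral_sum borel_measurable_suminf_chain)
    also have "\<dots> \<le> (\<Sum>zs\<in>permutations_of_set A. ennreal (path_prod green zs))"
      by (intro sum_mono nn_integral_suminf_chain_le summable)
    also have "\<dots> = ennreal (\<Sum>zs\<in>permutations_of_set A. path_prod green zs)"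
      by (intro sum_ennreal path_prod_nonneg green_nonneg summable)
    finally show "(\<integral>\<^sup>+S. (\<Sum>zs\<in>permutations_of_set A. \<Sum>t. chain S zs t) \<partial>walk_law)
        \<le> ennreal (\<Sum>zs\<in>permutations_of_set A. path_prod green zs)" .
  next
    fix S :: "nat \<Rightarrow> int ^ 'd"
    assume S: "S \<in> {S. \<forall>z\<in>A. local_time S z = of_nat n}"
    have "\<exists>t. S t = z" if "z \<in> A" for z
    proof (rule ccontr)
      assume "\<nexists>t. S t = z"
      then have "local_time S z = 0"
        by (simp add: local_time_def)
      with S that n show False
        by simp
    qed
    from chain_of_visits[OF A this] obtain zs
      where zs: "distinct zs" "set zs = A" "1 \<le> (\<Sum>t. chain S zs t)"
      by blast
    note zs(3)
    also have "(\<Sum>t. chain S zs t) \<le> (\<Sum>zs\<in>permutations_of_set A. \<Sum>t. chain S zs t)"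
      using zs by (intro member_le_sum permutations_of_setI) auto
    finally show "ennreal 1 \<le> (\<Sum>zs\<in>permutations_of_set A. \<Sum>t. chain S zs t)"
      by simp
  qed simp
  then show ?thesis
    by simp
qed

text \<open>Markov's inequality for the number of chains of \<open>k\<close> visits to
  \<open>A\<close>, whose expectation \<open>sum_path_prod_le\<close> bounds by
  \<open>M ^ k\<close>.\<close>

lemma binomial_measure_local_time_eq_le:
  fixes A :: "(int ^ 'd) set"
  assumes summable: "\<And>z :: int ^ 'd. summable (\<lambda>k. heat k z)"
    and A: "finite A" and M: "\<And>y. (\<Sum>z\<in>A. green (z - y)) \<le> M"
  shows "real (n * card A choose k) * measure walk_law {S. \<forall>z\<in>A. local_time S z = of_nat n} \<le> M ^ k"
proof (rule measure_le_of_nn_integral)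
  show "prob_space (walk_law :: (nat \<Rightarrow> int ^ 'd) measure)"
    by (rule walk_law.prob_space_axioms)
  show "{S. \<forall>z\<in>A. local_time S z = of_nat n} \<in> sets walk_law"
    by (rule sets_local_time_eq[OF A])
  let ?L = "{zs. set zs \<subseteq> A \<and> length zs = k}"
  have le: "(\<Sum>zs\<in>?L. path_prod green zs) \<le> M ^ k"
    by (intro sum_path_prod_le A M green_nonneg summable)
  have nonneg: "0 \<le> (\<Sum>zs\<in>?L. path_prod green zs)"
    by (intro sum_nonneg path_prod_nonneg green_nonneg summable)
  show "0 \<le> M ^ k"
    using le nonneg by linarith
  have "(\<integral>\<^sup>+S. (\<Sum>t. chains_in S A k t) \<partial>walk_law) = (\<integral>\<^sup>+S. (\<Sum>zs\<in>?L. \<Sum>t. chain S zs t) \<partial>walk_law)"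
    unfolding chains_in_def by (intro nn_integral_cong suminf_sum) simp
  also have "\<dots> = (\<Sum>zs\<in>?L. \<integral>\<^sup>+S. (\<Sum>t. chain S zs t) \<partial>walk_law)"
    by (intro nn_integral_sum borel_measurable_suminf_chain)
  also have "\<dots> \<le> (\<Sum>zs\<in>?L. ennreal (path_prod green zs))"
    by (intro sum_mono nn_integral_suminf_chain_le summable)
  also have "\<dots> = ennreal (\<Sum>zs\<in>?L. path_prod green zs)"
    by (intro sum_ennreal path_prod_nonneg green_nonneg summable)
  also have "\<dots> \<le> ennreal (M ^ k)"
    by (rule ennreal_leI[OF le])
  finally show "(\<integral>\<^sup>+S. (\<Sum>t. chains_in S A k t) \<partial>walk_law) \<le> ennreal (M ^ k)" .
next
  fix S :: "nat \<Rightarrow> int ^ 'd"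
  assume "S \<in> {S. \<forall>z\<in>A. local_time S z = of_nat n}"
  then show "ennreal (real (n * card A choose k)) \<le> (\<Sum>t. chains_in S A k t)"
    using binomial_le_suminf_chains_in[OF A, of S n k] by (simp add: ennreal_of_nat_eq_real_of_nat)
qed simp

section \<open>Green function estimates\<close>

text \<open>Jensen's inequality for \<open>x powr p\<close> with weights proportional to \<open>b\<close>. Indices with \<open>a k = 0\<close> are
  dropped in the proof because \<open>powr_convex\<close> is only available on the open half-line.\<close>

lemma sum_powr_le:
  fixes a b :: "'i \<Rightarrow> real"
  assumes I: "finite I" and a: "\<And>k. k \<in> I \<Longrightarrow> a k \<ge> 0" and b: "\<And>k. k \<in> I \<Longrightarrow> b k > 0" and p: "p \<ge> 1"
  shows "(\<Sum>k\<in>I. a k) powr p \<le> (\<Sum>k\<in>I. b k) powr (p - 1) * (\<Sum>k\<in>I. a k powr p * b k powr (1 - p))"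
proof -
  define J where "J = {k \<in> I. a k > 0}"
  define W where "W = (\<Sum>k\<in>J. b k)"
  have J: "finite J" "J \<subseteq> I" "\<And>k. k \<in> J \<Longrightarrow> a k > 0" "\<And>k. k \<in> J \<Longrightarrow> b k > 0"
    using I b by (auto simp: J_def)
  have sum_J: "(\<Sum>k\<in>I. a k) = (\<Sum>k\<in>J. a k)"
    using I a J(2) by (intro sum.mono_neutral_right) (force simp: J_def)+
  have nonneg: "0 \<le> (\<Sum>k\<in>I. a k powr p * b k powr (1 - p))"
    by (intro sum_nonneg mult_nonneg_nonneg) auto
  show ?thesis
  proof (cases "J = {}")
    case True
    then show ?thesis
      using nonneg by (simp add: sum_J)
  next
    case False
    then have W: "W > 0"
      unfolding W_def using J by (intro sum_pos) auto
    have "(\<Sum>k\<in>J. (b k / W) *\<^sub>R (a k * W / b k)) powr p \<le> (\<Sum>k\<in>J. b k / W * (a k * W / b k) powr p)"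
    proof (rule convex_on_sum[OF J(1) False powr_convex[OF p]])
      show "(\<Sum>k\<in>J. b k / W) = 1"
        using W by (simp add: W_def flip: sum_divide_distrib)
    qed (use J W in \<open>auto intro: less_imp_le\<close>)
    also have "(\<Sum>k\<in>J. (b k / W) *\<^sub>R (a k * W / b k)) = (\<Sum>k\<in>J. a k)"
      using J(4) W by (intro sum.cong) (auto simp: less_imp_neq[symmetric])
    also have "(\<Sum>k\<in>J. b k / W * (a k * W / b k) powr p) = (\<Sum>k\<in>J. W powr (p - 1) * (a k powr p * b k powr (1 - p)))"
    proof (rule sum.cong[OF refl])
      fix k assume "k \<in> J"
      then have "a k > 0" "b k > 0"
        using J by auto
      then show "b k / W * (a k * W / b k) powr p = W powr (p - 1) * (a k powr p * b k powr (1 - p))"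
        using W by (simp add: powr_mult powr_divide powr_diff)
    qed
    also have "\<dots> = W powr (p - 1) * (\<Sum>k\<in>J. a k powr p * b k powr (1 - p))"
      by (simp only: sum_distrib_left)
    also have "\<dots> \<le> (\<Sum>k\<in>I. b k) powr (p - 1) * (\<Sum>k\<in>I. a k powr p * b k powr (1 - p))"
    proof (rule mult_mono)
      have "W \<le> (\<Sum>k\<in>I. b k)"
        unfolding W_def using I J b by (intro sum_mono2) (auto intro: less_imp_le)
      then show "W powr (p - 1) \<le> (\<Sum>k\<in>I. b k) powr (p - 1)"
        using W p by (intro powr_mono2) auto
      show "(\<Sum>k\<in>J. a k powr p * b k powr (1 - p)) \<le> (\<Sum>k\<in>I. a k powr p * b k powr (1 - p))"
        using I J by (intro sum_mono2) auto
    qed (auto intro!: sum_nonneg)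
    finally show ?thesis
      unfolding sum_J .
  qed
qed

section \<open>Tails of sums of powers, and sums of Green functions over finite sets\<close>

lemma summable_Suc_powr: "s < -1 \<Longrightarrow> summable (\<lambda>k. real (Suc k) powr s)"
  using summable_Suc_iff[of "\<lambda>n. real n powr s"] summable_real_powr_iff[of s] by simp

text \<open>The mean value theorem gives a telescoping bound, used in place of comparison with an
  integral.\<close>

lemma powr_diff_ge:
  fixes x s :: real
  assumes "x > 0" "s > 1"
  shows "(s - 1) * (x + 1) powr (- s) \<le> x powr (1 - s) - (x + 1) powr (1 - s)"
proof -
  have "\<exists>\<xi>>x. \<xi> < x + 1 \<and> (x + 1) powr (1 - s) - x powr (1 - s) = (x + 1 - x) * ((1 - s) * \<xi> powr (1 - s - 1))"
  proof (rule MVT2)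
    show "((\<lambda>x. x powr (1 - s)) has_real_derivative (1 - s) * y powr (1 - s - 1)) (at y)" if "x \<le> y" for y
      using that assms(1) by (intro has_real_derivative_powr) simp
  qed simp
  then obtain \<xi> where \<xi>: "x < \<xi>" "\<xi> < x + 1"
      "(x + 1) powr (1 - s) - x powr (1 - s) = (1 - s) * \<xi> powr (- s)"
    by auto
  have "(x + 1) powr (- s) \<le> \<xi> powr (- s)"
    using \<xi> assms by (intro powr_mono2') auto
  then have "(s - 1) * (x + 1) powr (- s) \<le> (s - 1) * \<xi> powr (- s)"
    using assms by (intro mult_left_mono) auto
  with \<xi>(3) show ?thesis
    by (simp add: algebra_simps)
qed

lemma suminf_powr_tail_le:
  assumes s: "s > 1" and K: "K > 0"
  shows "(\<Sum>k. real (Suc (k + K)) powr (- s)) \<le> real K powr (1 - s) / (s - 1)"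
proof (rule suminf_le_const)
  have "(\<Sum>k<N. (s - 1) * real (Suc (k + K)) powr (- s)) \<le> real K powr (1 - s) - real (K + N) powr (1 - s)" for N
  proof (induction N)
    case (Suc N)
    then show ?case
      using powr_diff_ge[of "real (K + N)" s] K s by (simp add: add_ac)
  qed simp
  then have "(\<Sum>k<N. (s - 1) * real (Suc (k + K)) powr (- s)) \<le> real K powr (1 - s)" for N
    by (rule order_trans) simp
  then have "(s - 1) * (\<Sum>k<N. real (Suc (k + K)) powr (- s)) \<le> real K powr (1 - s)" for N
    by (simp only: sum_distrib_left)
  then show "(\<Sum>k<N. real (Suc (k + K)) powr (- s)) \<le> real K powr (1 - s) / (s - 1)" for N
    using s by (simp add: le_divide_eq mult.commute)
  show "summable (\<lambda>k. real (Suc (k + K)) powr (- s))"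
    using summable_ignore_initial_segment[OF summable_Suc_powr[of "- s"], of K] s by simp
qed

lemma summable_heat:
  fixes z :: "int ^ 'd"
  assumes "CARD('d) \<ge> 5"
  shows "summable (\<lambda>k. heat k z)"
proof -
  obtain C where C: "C \<ge> 1" "\<And>k (x :: int ^ 'd). heat k x \<le> C * real (Suc k) powr (- (CARD('d) / 2))"
    using heat_kernel_bound by blast
  show ?thesis
  proof (rule summable_comparison_test')
    show "summable (\<lambda>k. C * real (Suc k) powr (- (CARD('d) / 2)))"
      using assms by (intro summable_mult summable_Suc_powr) simp
    show "norm (heat k z) \<le> C * real (Suc k) powr (- (CARD('d) / 2))" if "k \<ge> 0" for k
      using C(2)[of k z] heat_nonneg[of k z] by simp
  qed
qed

lemma sum_heat_diff_le_1: "finite A \<Longrightarrow> (\<Sum>z\<in>A. heat k (z - y)) \<le> 1"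
  using sum_heat_le_1[of "(\<lambda>z. z - y) ` A" k] by (simp add: sum.reindex)

text \<open>The time sum is split at \<open>card A powr (2 / d)\<close>, where \<open>1\<close> and \<open>card A * k powr (- d / 2)\<close>,
  the two bounds for the probability of being in \<open>A\<close> at time \<open>k\<close>, balance.\<close>

lemma sum_green_le:
  assumes d: "CARD('d) \<ge> 5"
  shows "\<exists>B \<ge> 1. \<forall>A (y :: int ^ 'd). finite A \<longrightarrow> A \<noteq> {} \<longrightarrow>
    (\<Sum>z\<in>A. green (z - y)) \<le> B * real (card A) powr (2 / CARD('d))"
proof -
  define s where "s = CARD('d) / 2"
  have s: "s > 1" "2 / CARD('d) = 1 / s"
    using d by (auto simp: s_def)
  obtain C where C: "C \<ge> 1" "\<And>k (x :: int ^ 'd). heat k x \<le> C * real (Suc k) powr (- s)"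
    unfolding s_def using heat_kernel_bound by blast
  have bound: "(\<Sum>z\<in>A. green (z - y)) \<le> (2 + C / (s - 1)) * real (card A) powr (1 / s)"
    if A: "finite A" "A \<noteq> {}" for A and y :: "int ^ 'd"
  proof -
    define L where "L = real (card A)"
    define K where "K = nat \<lceil>L powr (1 / s)\<rceil>"
    have L: "L \<ge> 1"
      using A by (simp add: L_def Suc_leI card_gt_0_iff)
    then have root: "L powr (1 / s) \<ge> 1"
      using s by (intro ge_one_powr_ge_zero) auto
    have K: "L powr (1 / s) \<le> K" "K \<le> 2 * L powr (1 / s)" "K > 0"
      using root unfolding K_def by linarith+
    have green_le: "green (z - y) \<le> (\<Sum>k<K. heat k (z - y)) + C * (real K powr (1 - s) / (s - 1))" for z
    proof -
      have "(\<Sum>k. heat (k + K) (z - y)) \<le> (\<Sum>k. C * real (Suc (k + K)) powr (- s))"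
        using s by (intro suminf_le C summable_mult summable_ignore_initial_segment[OF summable_heat[OF d]]
            summable_ignore_initial_segment[OF summable_Suc_powr[of "- s"]]) auto
      also have "\<dots> = C * (\<Sum>k. real (Suc (k + K)) powr (- s))"
        using s by (intro suminf_mult summable_ignore_initial_segment[OF summable_Suc_powr[of "- s"]]) auto
      also have "\<dots> \<le> C * (real K powr (1 - s) / (s - 1))"
        using C s K by (intro mult_left_mono suminf_powr_tail_le) auto
      finally show ?thesis
        unfolding green_def suminf_split_initial_segment[OF summable_heat[OF d], of _ K] by simp
    qed
    have "(\<Sum>z\<in>A. green (z - y)) \<le> (\<Sum>z\<in>A. (\<Sum>k<K. heat k (z - y)) + C * (real K powr (1 - s) / (s - 1)))"
      by (intro sum_mono green_le)
    also have "\<dots> = (\<Sum>k<K. \<Sum>z\<in>A. heat k (z - y)) + L * (C * (real K powr (1 - s) / (s - 1)))"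
      by (simp add: sum.distrib sum.swap[of _ A] L_def)
    also have "\<dots> \<le> (\<Sum>k<K. 1) + L * (C * ((L powr (1 / s)) powr (1 - s) / (s - 1)))"
      using C s K L root
      by (intro add_mono sum_mono sum_heat_diff_le_1 A mult_left_mono divide_right_mono powr_mono2') auto
    also have "\<dots> = K + C / (s - 1) * (L powr 1 * (L powr (1 / s)) powr (1 - s))"
      using L by simp
    also have "L powr 1 * (L powr (1 / s)) powr (1 - s) = L powr (1 / s)"
      unfolding powr_powr powr_add[symmetric] using s
      by (intro arg_cong[of _ _ "\<lambda>e. L powr e"]) (simp add: divide_simps)
    also have "K + C / (s - 1) * L powr (1 / s) \<le> (2 + C / (s - 1)) * L powr (1 / s)"
      using K(2) by (simp add: algebra_simps)
    finally show ?thesis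
      unfolding L_def .
  qed
  have "2 + C / (s - 1) \<ge> 1"
    using C s by (simp add: add_increasing2)
  with bound show ?thesis
    unfolding s(2) by blast
qed

text \<open>Any exponent \<open>p < 2\<close> with a finite sum would do for the theorem. With the weights \<open>w k\<close> below the time sum converges
  if \<open>(p - 1) * (d / 2 - 9 / 8) > 1\<close>; for \<open>p = 15 / 8\<close> and \<open>d \<ge> 5\<close> the left-hand side is at least
  \<open>77 / 64\<close>.\<close>

lemma sum_green_powr_le:
  assumes d: "CARD('d) \<ge> 5"
  shows "\<exists>B. \<forall>A. finite A \<longrightarrow> (\<Sum>z\<in>A. green (z :: int ^ 'd) powr (15 / 8)) \<le> B"
proof -
  define s where "s = CARD('d) / 2"
  have s: "s \<ge> 5 / 2"
    using d by (simp add: s_def)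
  obtain C where C: "C \<ge> 1" "\<And>k (x :: int ^ 'd). heat k x \<le> C * real (Suc k) powr (- s)"
    unfolding s_def using heat_kernel_bound by blast
  define w where "w k = real (Suc k) powr (- (9 / 8))" for k
  \<comment> \<open>The exponent comes from \<open>s * (7 / 8) - (9 / 8) * (7 / 8)\<close> at
    \<open>s = 5 / 2\<close>: decay of the heat kernel minus the loss to the weights
    \<open>w\<close>.\<close>
  define v where "v k = real (Suc k) powr (- (77 / 64))" for k
  have w: "w k > 0" "summable w" "sum w {..<N} \<le> suminf w" for k N
    unfolding w_def by (auto intro!: summable_Suc_powr sum_le_suminf simp del: of_nat_Suc)
  have v: "summable v" "sum v {..<N} \<le> suminf v" for N
    unfolding v_def by (auto intro!: summable_Suc_powr sum_le_suminf simp del: of_nat_Suc)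
  define B where "B = suminf w powr (7 / 8) * (C powr (7 / 8) * suminf v)"
  have heat_powr: "(\<Sum>z\<in>A. heat k z powr (15 / 8) * w k powr (1 - 15 / 8)) \<le> C powr (7 / 8) * v k"
    if "finite A" for k and A :: "(int ^ 'd) set"
  proof -
    \<comment> \<open>One power of the heat kernel is kept, to be summed over \<open>z\<close> with
      total mass at most \<open>1\<close>; the remaining power \<open>7 / 8\<close> is bounded
      uniformly in \<open>z\<close>.\<close>
    have "heat k z powr (15 / 8) \<le> (C * real (Suc k) powr (- s)) powr (7 / 8) * heat k z" for z :: "int ^ 'd"
    proof -
      have "heat k z powr (15 / 8) = heat k z powr (7 / 8) * heat k z powr 1"
        unfolding powr_add[symmetric] by simp
      also have "\<dots> \<le> (C * real (Suc k) powr (- s)) powr (7 / 8) * heat k z powr 1"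
        using C heat_nonneg by (intro mult_right_mono powr_mono2) auto
      finally show ?thesis
        using heat_nonneg[of k z] by simp
    qed
    then have "(\<Sum>z\<in>A. heat k z powr (15 / 8)) \<le> (\<Sum>z\<in>A. (C * real (Suc k) powr (- s)) powr (7 / 8) * heat k z)"
      by (intro sum_mono)
    also have "\<dots> = (C * real (Suc k) powr (- s)) powr (7 / 8) * (\<Sum>z\<in>A. heat k z)"
      by (simp only: sum_distrib_left)
    also have "\<dots> \<le> (C * real (Suc k) powr (- s)) powr (7 / 8) * 1"
      by (intro mult_left_mono sum_heat_le_1 that) auto
    also have "\<dots> = C powr (7 / 8) * real (Suc k) powr (- s * (7 / 8))"
      using C by (simp only: powr_mult powr_ge_zero powr_powr mult_1_right)
    finally have "(\<Sum>z\<in>A. heat k z powr (15 / 8)) * w k powr (1 - 15 / 8)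
        \<le> C powr (7 / 8) * real (Suc k) powr (- s * (7 / 8)) * w k powr (1 - 15 / 8)"
      by (intro mult_right_mono) auto
    also have "\<dots> = C powr (7 / 8) * real (Suc k) powr (- s * (7 / 8) + 63 / 64)"
    proof -
      have "w k powr (1 - 15 / 8) = real (Suc k) powr (63 / 64)"
        unfolding w_def powr_powr by simp
      then show ?thesis
        by (simp only: powr_add mult.assoc)
    qed
    also have "\<dots> \<le> C powr (7 / 8) * v k"
      unfolding v_def using s by (intro mult_left_mono powr_mono) auto
    finally show ?thesis
      by (simp only: sum_distrib_right)
  qed
  \<comment> \<open>The time sum is truncated at \<open>N\<close>, where \<open>sum_powr_le\<close>
    applies, and \<open>N\<close> tends to infinity for fixed finite \<open>A\<close>.\<close>
  have "(\<Sum>z\<in>A. green z powr (15 / 8)) \<le> B" if A: "finite A" for A :: "(int ^ 'd) set"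
  proof (rule LIMSEQ_le_const2)
    show "(\<lambda>N. \<Sum>z\<in>A. (\<Sum>k<N. heat k z) powr (15 / 8)) \<longlonglongrightarrow> (\<Sum>z\<in>A. green z powr (15 / 8))"
      unfolding green_def
      by (intro tendsto_sum tendsto_powr' summable_LIMSEQ summable_heat[OF d] tendsto_const)
        (auto intro!: always_eventually sum_nonneg heat_nonneg)
    have "(\<Sum>z\<in>A. (\<Sum>k<N. heat k z) powr (15 / 8)) \<le> B" for N
    proof -
      have "(\<Sum>z\<in>A. (\<Sum>k<N. heat k z) powr (15 / 8))
          \<le> (\<Sum>z\<in>A. (\<Sum>k<N. w k) powr (15 / 8 - 1) * (\<Sum>k<N. heat k z powr (15 / 8) * w k powr (1 - 15 / 8)))"
        by (intro sum_mono sum_powr_le heat_nonneg w) auto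
      also have "\<dots> = (\<Sum>k<N. w k) powr (7 / 8) * (\<Sum>k<N. \<Sum>z\<in>A. heat k z powr (15 / 8) * w k powr (1 - 15 / 8))"
        by (simp add: sum_distrib_left[symmetric] sum.swap[of _ A])
      also have "\<dots> \<le> suminf w powr (7 / 8) * (\<Sum>k<N. C powr (7 / 8) * v k)"
        using w by (intro mult_mono powr_mono2 sum_mono heat_powr A sum_nonneg) (auto intro: less_imp_le)
      also have "\<dots> = suminf w powr (7 / 8) * (C powr (7 / 8) * (\<Sum>k<N. v k))"
        by (simp only: sum_distrib_left)
      also have "\<dots> \<le> B"
        unfolding B_def by (intro mult_left_mono v) auto
      finally show ?thesis .
    qed
    then show "\<exists>N. \<forall>n\<ge>N. (\<Sum>z\<in>A. (\<Sum>k<n. heat k z) powr (15 / 8)) \<le> B"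
      by blast
  qed
  then show ?thesis
    by blast
qed

section \<open>Intersections of level sets\<close>

lemma path_prod_powr:
  "(\<And>x. g x \<ge> 0) \<Longrightarrow> path_prod g zs powr p = path_prod (\<lambda>x. g x powr p) zs"
  by (induction zs) (auto simp: powr_mult path_prod_nonneg)

text \<open>With \<open>k\<close> the integer part of \<open>N / (3 * M)\<close>, the binomial
  coefficient is at least \<open>(N / k) ^ k\<close>, hence at least \<open>(3 * M) ^ k\<close>, and
  the probability is at most \<open>3 ^ k\<close> inverted. The \<open>1\<close> in the exponent
  pays for rounding and makes the case \<open>k = 0\<close> trivial.\<close>

lemma measure_local_time_eq_le_exp:
  fixes A :: "(int ^ 'd) set"
  assumes d: "CARD('d) \<ge> 5"
    and A: "finite A" and M: "\<And>y. (\<Sum>z\<in>A. green (z - y)) \<le> M" "M \<ge> 1"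
  shows "measure walk_law {S. \<forall>z\<in>A. local_time S z = of_nat n} \<le> exp (1 - real (n * card A) / (3 * M))"
proof -
  define N where "N = n * card A"
  define P where "P = measure walk_law {S. \<forall>z\<in>A. local_time S z = of_nat n}"
  define k where "k = nat \<lfloor>real N / (3 * M)\<rfloor>"
  have nonneg: "0 \<le> real N / (3 * M)"
    using M(2) by simp
  then have k: "real k \<le> real N / (3 * M)" "real N / (3 * M) < real k + 1"
    unfolding k_def by linarith+
  have P1: "P \<le> 1" "P \<ge> 0"
    by (auto simp: P_def)
  show ?thesis
  proof (cases "k = 0")
    case True
    then have "0 \<le> 1 - real N / (3 * M)"
      using k by simp
    then have "1 \<le> exp (1 - real N / (3 * M))"
      by simp
    then show ?thesis
      using P1 unfolding P_def N_def by linarith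
  next
    case False
    have "real k * (3 * M) \<le> N"
      using k(1) M(2) by (simp add: le_divide_eq)
    moreover have "real k * 1 \<le> real k * (3 * M)"
      using M(2) by (intro mult_left_mono) auto
    ultimately have kN: "k \<le> N"
      by simp
    have "(3 * M) ^ k \<le> (real N / real k) ^ k"
      using \<open>real k * (3 * M) \<le> N\<close> False M(2) by (intro power_mono) (auto simp: le_divide_eq mult.commute)
    also have "\<dots> \<le> real (N choose k)"
      by (rule binomial_ge_n_over_k_pow_k[OF kN])
    finally have "(3 * M) ^ k * P \<le> real (N choose k) * P"
      using P1 by (intro mult_right_mono)
    also have "\<dots> \<le> M ^ k"
      unfolding N_def P_def
      by (rule binomial_measure_local_time_eq_le[OF summable_heat[OF d] A M(1)])
    finally have "M ^ k * (3 ^ k * P) \<le> M ^ k * 1"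
      by (simp add: power_mult_distrib mult_ac)
    then have "3 ^ k * P \<le> 1"
      using M(2) by (subst (asm) mult_le_cancel_left_pos) auto
    then have "P \<le> 1 / 3 ^ k"
      by (simp add: le_divide_eq mult.commute)
    also have "\<dots> \<le> 1 / exp 1 ^ k"
      using exp_le by (intro divide_left_mono power_mono) auto
    also have "\<dots> = exp (- real k)"
      by (simp add: exp_minus inverse_eq_divide flip: exp_of_nat_mult)
    also have "\<dots> \<le> exp (1 - real N / (3 * M))"
      using k(2) by simp
    finally show ?thesis
      unfolding P_def N_def .
  qed
qed

lemma measure_local_time_eq_exp_bound:
  assumes d: "CARD('d) \<ge> 5"
  shows "\<exists>\<kappa> > 0. \<forall>n (A :: (int ^ 'd) set). finite A \<longrightarrow> A \<noteq> {} \<longrightarrow>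
    measure walk_law {S. \<forall>z\<in>A. local_time S z = of_nat n}
      \<le> exp (1 - \<kappa> * real n * real (card A) powr (1 - 2 / real CARD('d)))"
proof -
  obtain B where B: "B \<ge> 1" "\<And>A (y :: int ^ 'd). finite A \<Longrightarrow> A \<noteq> {} \<Longrightarrow>
      (\<Sum>z\<in>A. green (z - y)) \<le> B * real (card A) powr (2 / CARD('d))"
    using sum_green_le[OF d] by blast
  show ?thesis
  proof (intro exI[of _ "1 / (3 * B)"] conjI allI impI)
    fix n and A :: "(int ^ 'd) set"
    assume A: "finite A" "A \<noteq> {}"
    define L where "L = real (card A)"
    define M where "M = B * L powr (2 / CARD('d))"
    have L: "L \<ge> 1"
      using A by (simp add: L_def Suc_leI card_gt_0_iff)
    then have "1 * 1 \<le> B * L powr (2 / CARD('d))"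
      using B(1) by (intro mult_mono ge_one_powr_ge_zero) auto
    then have M: "M \<ge> 1"
      by (simp add: M_def)
    have "measure walk_law {S. \<forall>z\<in>A. local_time S z = of_nat n} \<le> exp (1 - real (n * card A) / (3 * M))"
      by (rule measure_local_time_eq_le_exp[OF d A(1) _ M]) (use B(2)[OF A] in \<open>simp add: M_def L_def\<close>)
    also have "real (n * card A) / (3 * M) = 1 / (3 * B) * n * L powr (1 - 2 / CARD('d))"
      using L B(1) by (simp add: M_def L_def powr_diff)
    finally show "measure walk_law {S. \<forall>z\<in>A. local_time S z = of_nat n}
        \<le> exp (1 - 1 / (3 * B) * real n * real (card A) powr (1 - 2 / real CARD('d)))"
      by (simp only: L_def)
  qed (use B in simp)
qed

text \<open>Continuity from below along an enumeration of \<open>I\<close> reduces the union bound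
  to finite subfamilies, over which the sums of path products are controlled.\<close>

lemma (in finite_measure) measure_le_countable_cover:
  assumes I: "countable I" and F: "\<And>i. i \<in> I \<Longrightarrow> F i \<in> sets M" and E: "E \<subseteq> (\<Union>i\<in>I. F i)"
    and bound: "\<And>J. finite J \<Longrightarrow> J \<subseteq> I \<Longrightarrow> (\<Sum>i\<in>J. measure M (F i)) \<le> b"
  shows "measure M E \<le> b"
proof (cases "I = {}")
  case True
  then have "E = {}"
    using E by simp
  then show ?thesis
    using bound[of "{}"] by simp
next
  case False
  define e where "e = from_nat_into I"
  have e: "range e = I"
    unfolding e_def by (rule range_from_nat_into[OF False I])
  define G where "G n = (\<Union>i\<in>e ` {..<n}. F i)" for n
  have G: "G n \<in> sets M" for n
    unfolding G_def using e F by (intro sets.finite_UN) auto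
  have G_le: "measure M (G n) \<le> b" for n
  proof -
    have "measure M (G n) \<le> (\<Sum>i\<in>e ` {..<n}. measure M (F i))"
      unfolding G_def using e F by (intro measure_UNION_le) auto
    also have "\<dots> \<le> b"
      using e by (intro bound) auto
    finally show ?thesis .
  qed
  have UN: "(\<Union>n. G n) = (\<Union>i\<in>I. F i)"
    unfolding G_def e[symmetric] by blast
  have "incseq G"
    unfolding incseq_def G_def by (intro allI impI UN_mono image_mono) auto
  then have "(\<lambda>n. measure M (G n)) \<longlonglongrightarrow> measure M (\<Union>n. G n)"
    using G by (intro finite_Lim_measure_incseq) auto
  then have "measure M (\<Union>n. G n) \<le> b"
    by (rule LIMSEQ_le_const2) (use G_le in blast)
  moreover have "measure M E \<le> measure M (\<Union>n. G n)"
    using E G unfolding UN[symmetric] by (intro finite_measure_mono) auto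
  ultimately show ?thesis
    by linarith
qed

theorem corollary1p7:
  assumes "CARD('d::finite) \<ge> 5"
  shows "\<exists>\<kappa> C :: real. \<kappa> > 0 \<and> C > 0 \<and>
    (\<forall>n m L :: nat. n > 0 \<longrightarrow> m > 0 \<longrightarrow> L > 0 \<longrightarrow>
      \<P>(\<omega> in (walk_law :: (nat \<Rightarrow> int ^ 'd) measure) \<Otimes>\<^sub>M (walk_law :: (nat \<Rightarrow> int ^ 'd) measure).
          card_at_least (level_set (fst \<omega>) n \<inter> level_set (snd \<omega>) m) L)
        \<le> (C * real n * real m) ^ L * fact L ^ (2 * CARD('d))
            * exp (- \<kappa> * (real n + real m) * real L powr (1 - 2 / real CARD('d))))"
proof -
  note d = assms
  let ?W = "walk_law :: (nat \<Rightarrow> int ^ 'd) measure"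
  interpret pair: pair_prob_space ?W ?W ..
  obtain \<kappa> where \<kappa>: "\<kappa> > 0" "\<And>n (A :: (int ^ 'd) set). finite A \<Longrightarrow> A \<noteq> {} \<Longrightarrow>
      measure walk_law {S. \<forall>z\<in>A. local_time S z = of_nat n}
        \<le> exp (1 - \<kappa> * real n * real (card A) powr (1 - 2 / real CARD('d)))"
    using measure_local_time_eq_exp_bound[OF d] by blast
  obtain K0 where K0: "\<And>A. finite A \<Longrightarrow> (\<Sum>z\<in>A. green (z :: int ^ 'd) powr (15 / 8)) \<le> K0"
    using sum_green_powr_le[OF d] by blast
  \<comment> \<open>The maximum with \<open>1\<close> makes the final constant positive and the
    powers of \<open>K\<close> monotone.\<close>
  define K where "K = max 1 K0"
  define g where "g z = green z powr (15 / 8)" for z :: "int ^ 'd"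
  have green0: "green z \<ge> 0" for z :: "int ^ 'd"
    by (rule green_nonneg[OF summable_heat[OF d]])
  have g_sum: "(\<Sum>z\<in>A. g (z - y)) \<le> K" if "finite A" for A and y :: "int ^ 'd"
    using K0[of "(\<lambda>z. z - y) ` A"] that by (simp add: sum.reindex g_def K_def)
  have g0: "g z \<ge> 0" for z
    by (simp add: g_def)
  have main: "\<P>(\<omega> in ?W \<Otimes>\<^sub>M ?W. card_at_least (level_set (fst \<omega>) n \<inter> level_set (snd \<omega>) m) L)
      \<le> (3 * K * real n * real m) ^ L * fact L ^ (2 * CARD('d))
            * exp (- (\<kappa> / 16) * (real n + real m) * real L powr (1 - 2 / real CARD('d)))"
    if n: "n > 0" and m: "m > 0" and L: "L > 0" for n m L
  proof -
    define x where "x = real L powr (1 - 2 / real CARD('d))"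
    define P where "P n A = measure ?W {S. \<forall>z\<in>A. local_time S z = of_nat n}" for n and A :: "(int ^ 'd) set"
    define I where "I = {A :: (int ^ 'd) set. finite A \<and> card A = L}"
    define F where "F A = {S. \<forall>z\<in>A. local_time S z = of_nat n} \<times> {S. \<forall>z\<in>A. local_time S z = of_nat m}"
      for A :: "(int ^ 'd) set"
    \<comment> \<open>The product of the two probabilities is split as \<open>Q powr (1 / 16) * Q powr (15 / 16)\<close>: the first
      factor yields the exponential decay, the second the summability over \<open>A\<close>.\<close>
    define c where "c = exp ((2 - \<kappa> * (real n + real m) * x) / 16) * fact L ^ 2"
    have c0: "c \<ge> 0"
      by (simp add: c_def)
    \<comment> \<open>An enumeration of \<open>A\<close> with maximal path product. Replacing the
      sum over enumerations by \<open>fact L\<close> times one product lets the power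
      \<open>15 / 8\<close> pass to the single Green functions.\<close>
    define order where "order A = (SOME zs. zs \<in> permutations_of_set A \<and>
        (\<forall>ys\<in>permutations_of_set A. path_prod green ys \<le> path_prod green zs))" for A :: "(int ^ 'd) set"
    have order: "order A \<in> permutations_of_set A"
        "\<And>ys. ys \<in> permutations_of_set A \<Longrightarrow> path_prod green ys \<le> path_prod green (order A)"
      if "A \<in> I" for A
    proof -
      let ?V = "path_prod green ` permutations_of_set A"
      have fin: "finite ?V" "?V \<noteq> {}"
        using that by (auto simp: I_def permutations_of_set_nonempty)
      then obtain zs where zs: "zs \<in> permutations_of_set A" "Max ?V = path_prod green zs"
        using Max_in[OF fin] by (elim imageE)
      then have "\<exists>zs. zs \<in> permutations_of_set A \<and> (\<forall>ys\<in>permutations_of_set A. path_prod green ys \<le> path_prod green zs)"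
        using Max_ge[OF fin(1)] by (intro exI[of _ zs]) auto
      from someI_ex[OF this] show "order A \<in> permutations_of_set A"
          "\<And>ys. ys \<in> permutations_of_set A \<Longrightarrow> path_prod green ys \<le> path_prod green (order A)"
        unfolding order_def by blast+
    qed
    have P_fact: "P j A \<le> fact L * path_prod green (order A)" if "A \<in> I" "j > 0" for j A
    proof -
      have A: "finite A" "card A = L"
        using that by (auto simp: I_def)
      have "P j A \<le> (\<Sum>zs\<in>permutations_of_set A. path_prod green zs)"
        unfolding P_def by (rule measure_local_time_eq_le_permutations[OF summable_heat[OF d] A(1) that(2)])
      also have "\<dots> \<le> (\<Sum>zs\<in>permutations_of_set A. path_prod green (order A))"
        by (intro sum_mono order(2) that)
      also have "\<dots> = fact L * path_prod green (order A)"
        using A by simp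
      finally show ?thesis .
    qed
    have P0: "P j A \<ge> 0" for j A
      by (simp add: P_def)
    have P_exp: "P j A \<le> exp (1 - \<kappa> * real j * x)" if "A \<in> I" for j A
    proof -
      have "finite A" "card A = L"
        using that by (auto simp: I_def)
      moreover from this have "A \<noteq> {}"
        using L by auto
      ultimately show ?thesis
        using \<kappa>(2)[of A j] by (simp add: P_def x_def)
    qed
    have F_measure: "measure (?W \<Otimes>\<^sub>M ?W) (F A) = P n A * P m A" if "A \<in> I" for A
    proof -
      have "finite A"
        using that by (simp add: I_def)
      then show ?thesis
        unfolding F_def P_def measure_def
        by (subst walk_law.emeasure_pair_measure_Times) (simp_all only: sets_local_time_eq enn2real_mult)
    qed
    have F_le: "measure (?W \<Otimes>\<^sub>M ?W) (F A) \<le> c * path_prod g (order A)" if A: "A \<in> I" for A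
    proof -
      define Q where "Q = P n A * P m A"
      have Q0: "Q \<ge> 0"
        unfolding Q_def by (intro mult_nonneg_nonneg P0)
      have PP0: "path_prod green (order A) \<ge> 0"
        by (intro path_prod_nonneg green0)
      have "Q \<le> exp (1 - \<kappa> * real n * x) * exp (1 - \<kappa> * real m * x)"
        unfolding Q_def by (intro mult_mono P_exp[OF A] P0) auto
      also have "\<dots> = exp (2 - \<kappa> * (real n + real m) * x)"
        by (simp add: algebra_simps flip: exp_add)
      finally have "Q powr (1 / 16) \<le> exp (2 - \<kappa> * (real n + real m) * x) powr (1 / 16)"
        using Q0 by (intro powr_mono2) auto
      then have Q1: "Q powr (1 / 16) \<le> exp ((2 - \<kappa> * (real n + real m) * x) / 16)"
        by (simp add: powr_def)
      have "Q \<le> (fact L * path_prod green (order A)) * (fact L * path_prod green (order A))"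
        unfolding Q_def using PP0 by (intro mult_mono P_fact[OF A] P0 n m) auto
      then have "Q powr (15 / 16) \<le> ((fact L * path_prod green (order A)) powr 2) powr (15 / 16)"
        using Q0 PP0 by (intro powr_mono2) (auto simp: power2_eq_square)
      also have "\<dots> = fact L powr (15 / 8) * path_prod g (order A)"
        unfolding powr_powr using green0 PP0 by (simp add: powr_mult path_prod_powr g_def[abs_def])
      also have "\<dots> \<le> fact L ^ 2 * path_prod g (order A)"
      proof (intro mult_right_mono path_prod_nonneg g0)
        have "fact L powr (15 / 8) \<le> (fact L powr 2 :: real)"
          using fact_ge_1[of L, where 'a = real] by (intro powr_mono) auto
        then show "fact L powr (15 / 8) \<le> (fact L ^ 2 :: real)"
          by simp
      qed
      finally have Q2: "Q powr (15 / 16) \<le> fact L ^ 2 * path_prod g (order A)" .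
      have "Q = Q powr (1 / 16) * Q powr (15 / 16)"
        unfolding powr_add[symmetric] using Q0 by simp
      also have "\<dots> \<le> exp ((2 - \<kappa> * (real n + real m) * x) / 16) * (fact L ^ 2 * path_prod g (order A))"
        using Q1 Q2 by (intro mult_mono) auto
      finally show ?thesis
        unfolding F_measure[OF A] c_def Q_def by (simp only: mult.assoc)
    qed
    have "\<P>(\<omega> in ?W \<Otimes>\<^sub>M ?W. card_at_least (level_set (fst \<omega>) n \<inter> level_set (snd \<omega>) m) L) \<le> c * K ^ L"
    proof (rule pair.measure_le_countable_cover)
      show "countable I"
        unfolding I_def by (rule countable_subset[OF _ countable_Collect_finite]) auto
      show "F A \<in> sets (?W \<Otimes>\<^sub>M ?W)" if "A \<in> I" for A
        unfolding F_def using that by (intro pair_measureI sets_local_time_eq) (auto simp: I_def)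
      show "{\<omega> \<in> space (?W \<Otimes>\<^sub>M ?W). card_at_least (level_set (fst \<omega>) n \<inter> level_set (snd \<omega>) m) L} \<subseteq> (\<Union>A\<in>I. F A)"
        unfolding card_at_least_iff level_set_def I_def F_def by fastforce
      show "(\<Sum>A\<in>J. measure (?W \<Otimes>\<^sub>M ?W) (F A)) \<le> c * K ^ L" if J: "finite J" "J \<subseteq> I" for J
      proof -
        have order_set: "set (order A) = A" "length (order A) = L" if "A \<in> J" for A
        proof -
          have AI: "A \<in> I"
            using that J by blast
          have p: "set (order A) = A" "distinct (order A)"
            using order(1)[OF AI] by (auto dest: permutations_of_setD)
          show "set (order A) = A" "length (order A) = L"
            using p AI distinct_card[OF p(2)] by (auto simp: I_def)
        qed
        \<comment> \<open>Since \<open>A\<close> is recovered from its list, the sum over sets is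
          part of a sum over all lists of length \<open>L\<close> in a finite set, which is at most
          \<open>K ^ L\<close>.\<close>
        have inj: "inj_on order J"
          by (rule inj_on_inverseI[of _ set]) (rule order_set)
        have finite_UN: "finite (\<Union>J)"
          using J by (auto simp: I_def)
        have "(\<Sum>A\<in>J. measure (?W \<Otimes>\<^sub>M ?W) (F A)) \<le> (\<Sum>A\<in>J. c * path_prod g (order A))"
          using J by (intro sum_mono F_le) auto
        also have "\<dots> = c * (\<Sum>zs\<in>order ` J. path_prod g zs)"
          by (simp add: sum.reindex[OF inj] sum_distrib_left)
        also have "\<dots> \<le> c * (\<Sum>zs | set zs \<subseteq> \<Union>J \<and> length zs = L. path_prod g zs)"
        proof (intro mult_left_mono sum_mono2 c0 finite_lists_length_eq finite_UN path_prod_nonneg g0)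
          show "order ` J \<subseteq> {zs. set zs \<subseteq> \<Union>J \<and> length zs = L}"
            using order_set by blast
        qed
        also have "\<dots> \<le> c * K ^ L"
          by (intro mult_left_mono c0 sum_path_prod_le finite_UN g0 g_sum)
        finally show ?thesis .
      qed
    qed
    also have "c * K ^ L = exp (1 / 8) * K ^ L * fact L ^ 2 * exp (- (\<kappa> / 16) * (real n + real m) * x)"
    proof -
      have "(2 - \<kappa> * (real n + real m) * x) / 16 = 1 / 8 + (- (\<kappa> / 16) * (real n + real m) * x)"
        by (simp add: diff_divide_distrib)
      then show ?thesis
        unfolding c_def by (simp only: exp_add mult_ac)
    qed
    \<comment> \<open>As \<open>L\<close>, \<open>n\<close> and \<open>m\<close> are positive,
      \<open>exp (1 / 8)\<close> is absorbed in \<open>3 ^ L\<close>, and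
      \<open>real n * real m\<close> is at least \<open>1\<close>.\<close>
    also have "\<dots> \<le> (3 * K * real n * real m) ^ L * fact L ^ (2 * CARD('d)) * exp (- (\<kappa> / 16) * (real n + real m) * x)"
    proof (rule mult_right_mono, rule mult_mono)
      have "exp (1 / 8 :: real) \<le> 3 ^ 1"
        unfolding power_one_right by (rule order_trans[OF _ exp_le]) simp
      also have "(3 :: real) ^ 1 \<le> 3 ^ L"
        using L by (intro power_increasing) auto
      finally have "exp (1 / 8) * K ^ L \<le> 3 ^ L * K ^ L"
        by (intro mult_right_mono) (auto simp: K_def)
      also have "\<dots> = (3 * K * 1) ^ L"
        by (simp add: power_mult_distrib)
      also have "\<dots> \<le> (3 * K * (real n * real m)) ^ L"
      proof (intro power_mono mult_left_mono)
        have "1 * 1 \<le> real n * real m"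
          using n m by (intro mult_mono) auto
        then show "1 \<le> real n * real m"
          by simp
      qed (auto simp: K_def)
      finally show "exp (1 / 8) * K ^ L \<le> (3 * K * real n * real m) ^ L"
        by (simp only: mult.assoc)
      show "fact L ^ 2 \<le> (fact L ^ (2 * CARD('d)) :: real)"
        by (intro power_increasing fact_ge_1) (simp add: Suc_leI)
    qed (auto simp: K_def)
    finally show ?thesis
      unfolding x_def .
  qed
  have "\<kappa> / 16 > 0" "3 * K > 0"
    using \<kappa>(1) by (auto simp: K_def)
  with main show ?thesis
    by blast
qed

end
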